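(* Let $n\ge 1$, $l\ge 1$, and let $P\in\mathcal{P}^n(l)$ with $\mathrm{vol}(P)=(n\,l+1)/n!$. Then $\mathrm{a}_i(P)=\mathrm{a}_i(S_n(l))=l$ for all $1\le i\le n$.
   Context: $\mathcal{P}^n$ is the set of all convex lattice $n$-polytopes in $\mathbb{R}^n$ (vertices in $\mathbb{Z}^n$, dimension $n$). For $S\subset\mathbb{R}^n$, $\mathrm{G}(S)=\#(S\cap\mathbb{Z}^n)$. $\mathcal{P}^n(l)$ is the set of $P\in\mathcal{P}^n$ having exactly $l$ interior lattice points. $\mathrm{vol}$ is the $n$-dimensional Lebesgue measure. For $P\in\mathcal{P}^n$ the function $k\mapsto \mathrm{G}(kP)$, $k\in\mathbb{N}$, is a polynomial of degree $n$ (the Ehrhart polynomial), and the numbers $\mathrm{a}_i(P)$, $0\le i\le n$, are defined by $\mathrm{G}(kP)=\sum_{i=0}^n \mathrm{a}_i(P)\binom{k+n-i}{n}$. $S_n(l)=\mathrm{conv}\{e_1,\dots,e_n,-l\sum_{i=1}^n e_i\}$, where $e_i$ is the $i$-th unit vector. *)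

theory Defs
  imports "HOL-Analysis.Analysis"
begin

definition integer_lattice :: "(real ^ 'n) set" where
  "integer_lattice = {x. \<forall>i. x $ i \<in> \<int>}"

text \<open>Number of lattice points. It is only meaningful for sets with finitely many lattice
  points (\<^const>\<open>card\<close> is 0 otherwise); polytopes and their interiors are bounded.\<close>

definition lattice_count :: "(real ^ 'n) set \<Rightarrow> nat" where
  "lattice_count S = card (S \<inter> integer_lattice)"

definition lattice_polytopes :: "(real ^ 'n) set set" where
  "lattice_polytopes = {P. polytope P \<and> aff_dim P = int CARD('n) \<and>
     (\<forall>v. v extreme_point_of P \<longrightarrow> v \<in> integer_lattice)}"

definition lattice_polytopes_interior :: "nat \<Rightarrow> (real ^ 'n) set set" where
  "lattice_polytopes_interior l = {P \<in> lattice_polytopes. lattice_count (interior P) = l}"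

text \<open>The coefficients are the unique real numbers indexed by \<open>0, \<dots>, n\<close> satisfying
  \<open>G(kP) = \<Sum>i\<le>n. a\<^sub>i * binomial (k + n - i) n\<close> for all \<open>k\<close>; the sequence is padded by zero beyond
  \<open>n\<close> so that it is unique as a function on \<^typ>\<open>nat\<close>. The subtraction does not truncate, as
  \<open>i \<le> n\<close>. The case \<open>k = 0\<close> is included; it is consistent with the others, since \<open>0P = {0}\<close> for
  nonempty \<open>P\<close>.\<close>

definition ehrhart_coeff :: "(real ^ 'n) set \<Rightarrow> nat \<Rightarrow> real" where
  "ehrhart_coeff P = (THE a.
     (\<forall>k::nat. real (lattice_count ((\<lambda>x. real k *\<^sub>R x) ` P)) =
        (\<Sum>i=0..CARD('n). a i * real ((k + CARD('n) - i) choose CARD('n)))) \<and>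
     (\<forall>i>CARD('n). a i = 0))"

definition S_simplex :: "nat \<Rightarrow> (real ^ 'n) set" where
  "S_simplex l = convex hull
     (range (\<lambda>i. axis i 1) \<union> {- (real l *\<^sub>R (\<Sum>i\<in>UNIV. axis i 1))})"

end

theory Submission
  imports Defs
begin

text \<open>
  Write \<open>n\<close> for the dimension and measure volumes in units of \<open>1/n!\<close>, so that every lattice simplex
  has an integral positive volume (\<open>nvol\<close>). Dissect \<open>P\<close> into lattice simplices and insert the interior
  lattice points one at a time by star subdivision. If the new point lies in the relative interiors
  of faces of dimensions \<open>j\<^sub>1, \<dots>, j\<^sub>m\<close> of the \<open>m\<close> simplices that contain it, the number of simplices
  grows by \<open>j\<^sub>1 + \<dots> + j\<^sub>m\<close>. The tangent cones of these simplices cover all directions, and linear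
  algebra turns this into \<open>j\<^sub>1 + \<dots> + j\<^sub>m \<ge> n\<close>, where equality forces every \<open>j\<^sub>i\<close> to be \<open>1\<close> or \<open>n\<close>
  (\<open>star_increment_ge\<close>, \<open>star_increment_eq\<close>). Hence \<open>nvol P \<ge> |T| + n l\<close> for every dissection \<open>T\<close> of \<open>P\<close>
  that has no interior lattice point among its vertices (\<open>nvol_lower_bound\<close>).

  Applied to a triangulation on the vertices of \<open>P\<close> (\<open>regular_triangulation\<close>), the volume hypothesis
  leaves room for one simplex only, so \<open>P\<close> is a simplex for which the bound is attained
  (\<open>tight\<close>). Such a simplex has no lattice points on its boundary except the vertices, and every insertion
  has increment exactly \<open>n\<close>.

  For \<open>n \<noteq> 2\<close> this rigidity makes the simplex split recursively. If \<open>n \<ge> 3\<close>, there is an interior lattice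
  point \<open>p\<close> such that no further lattice point lies between \<open>p\<close> and a vertex; if \<open>n = 1\<close>, any interior lattice
  point will do. Coning from \<open>p\<close> then gives \<open>n + 1\<close> smaller tight simplices that share out the other interior lattice points
  (\<open>tight_split\<close>). To count lattice points without overlaps, the simplices are made half-open with
  respect to a generic point \<open>q\<close>. A unimodular half-open simplex with \<open>r\<close> facets removed has
  \<open>(k + n - r) choose n\<close> lattice points in its \<open>k\<close>-th dilate, and coning from \<open>p\<close> replaces one simplex of
  type \<open>r\<close> by one of type \<open>r\<close> and one of each type \<open>1, \<dots>, n\<close> (\<open>rank_sum\<close>). So each interior lattice
  point contributes \<open>1\<close> to each of \<open>a\<^sub>1, \<dots>, a\<^sub>n\<close> (\<open>tight_half_open_count\<close>).

  For \<open>n = 2\<close> such a point \<open>p\<close> need not exist, but three types of half-open triangles are few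
  enough to be determined by their total number and by the number of lattice points of \<open>P\<close>
  (\<open>tight_triangle_count\<close>).

  The simplex \<open>S\<^sub>n(l)\<close> is tight as well, so both sides of the claimed equality are computed by the same
  lemma \<open>ehrhart_coeff_tight\<close>.
\<close>

section \<open>Barycentric coordinates in a full-dimensional simplex\<close>

definition full_simplex :: "'a::euclidean_space set \<Rightarrow> bool" where
  "full_simplex s \<longleftrightarrow> card s = Suc DIM('a) \<and> affine hull s = UNIV"

text \<open>
  The barycentric coordinates of \<open>x\<close> as a function of the vertex. Only the values on \<open>s\<close> have a
  meaning, and they are unique when \<open>s\<close> is a full-dimensional simplex (\<open>bary_unique\<close>).
\<close>

definition bary :: "'a::euclidean_space set \<Rightarrow> 'a \<Rightarrow> 'a \<Rightarrow> real" where
  "bary s x = (SOME u. sum u s = 1 \<and> (\<Sum>v\<in>s. u v *\<^sub>R v) = x)"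

lemma full_simplex_finite: "full_simplex s \<Longrightarrow> finite s"
  unfolding full_simplex_def using card.infinite by fastforce

lemma full_simplex_iff_independent:
  fixes s :: "'a::euclidean_space set"
  shows "full_simplex s \<longleftrightarrow> card s = Suc DIM('a) \<and> \<not> affine_dependent s"
proof -
  have "finite s" if "card s = Suc DIM('a)"
    using that card.infinite by fastforce
  then show ?thesis
    unfolding full_simplex_def affine_independent_iff_card aff_dim_eq_full[symmetric]
    by auto
qed

lemma
  assumes "full_simplex s"
  shows sum_bary: "sum (bary s x) s = 1"
    and bary_combination: "(\<Sum>v\<in>s. bary s x v *\<^sub>R v) = x"
proof -
  have "x \<in> affine hull s" using assms by (simp add: full_simplex_def)
  then have "\<exists>u. sum u s = 1 \<and> (\<Sum>v\<in>s. u v *\<^sub>R v) = x"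
    using affine_hull_finite[OF full_simplex_finite[OF assms]] by auto
  then have "sum (bary s x) s = 1 \<and> (\<Sum>v\<in>s. bary s x v *\<^sub>R v) = x"
    unfolding bary_def by (rule someI_ex)
  then show "sum (bary s x) s = 1" "(\<Sum>v\<in>s. bary s x v *\<^sub>R v) = x" by auto
qed

lemma bary_unique:
  assumes s: "full_simplex s" and u: "sum u s = 1" "(\<Sum>v\<in>s. u v *\<^sub>R v) = x" and "v \<in> s"
  shows "bary s x v = u v"
proof (rule ccontr)
  assume ne: "bary s x v \<noteq> u v"
  let ?w = "\<lambda>v. bary s x v - u v"
  have "sum ?w s = 0" "(\<Sum>v\<in>s. ?w v *\<^sub>R v) = 0"
    using u sum_bary[OF s] bary_combination[OF s]
    by (simp_all add: sum_subtractf scaleR_left_diff_distrib)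
  then have "affine_dependent s"
    using affine_dependent_explicit_finite[OF full_simplex_finite[OF s]] ne \<open>v \<in> s\<close> by force
  then show False using s full_simplex_iff_independent by auto
qed

lemma bary_affine:
  assumes s: "full_simplex s" and I: "finite I" "sum c I = 1" and "v \<in> s"
  shows "bary s (\<Sum>i\<in>I. c i *\<^sub>R y i) v = (\<Sum>i\<in>I. c i * bary s (y i) v)"
proof (rule bary_unique[OF s _ _ \<open>v \<in> s\<close>])
  have "(\<Sum>v\<in>s. \<Sum>i\<in>I. c i * bary s (y i) v) = (\<Sum>i\<in>I. c i * sum (bary s (y i)) s)"
    by (subst sum.swap) (simp add: sum_distrib_left)
  then show "(\<Sum>v\<in>s. \<Sum>i\<in>I. c i * bary s (y i) v) = 1"
    by (simp add: sum_bary[OF s] I)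
  have "(\<Sum>v\<in>s. (\<Sum>i\<in>I. c i * bary s (y i) v) *\<^sub>R v)
      = (\<Sum>i\<in>I. c i *\<^sub>R (\<Sum>v\<in>s. bary s (y i) v *\<^sub>R v))"
    by (simp add: scaleR_sum_left scaleR_sum_right) (rule sum.swap)
  then show "(\<Sum>v\<in>s. (\<Sum>i\<in>I. c i * bary s (y i) v) *\<^sub>R v) = (\<Sum>i\<in>I. c i *\<^sub>R y i)"
    by (simp add: bary_combination[OF s])
qed

lemma bary_segment:
  assumes s: "full_simplex s" and "v \<in> s"
  shows "bary s (x + t *\<^sub>R (y - x)) v = bary s x v + t * (bary s y v - bary s x v)"
proof -
  have "bary s (\<Sum>i\<in>{False,True}. (if i then t else 1 - t) *\<^sub>R (if i then y else x)) v
      = (\<Sum>i\<in>{False,True}. (if i then t else 1 - t) * bary s (if i then y else x) v)"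
    by (rule bary_affine[OF s _ _ \<open>v \<in> s\<close>]) auto
  then show ?thesis by (simp add: algebra_simps)
qed

lemma bary_vertex:
  assumes s: "full_simplex s" and "v \<in> s" "w \<in> s"
  shows "bary s w v = (if v = w then 1 else 0)"
  using full_simplex_finite[OF s] assms
  by (intro bary_unique[OF s]) (auto simp: if_distrib[of "\<lambda>c. c *\<^sub>R _"] sum.delta cong: if_cong)

lemma bary_eqI:
  assumes "full_simplex s" "\<And>v. v \<in> s \<Longrightarrow> bary s x v = bary s y v"
  shows "x = y"
  using bary_combination[OF assms(1)] assms(2) by (metis (mono_tags, lifting) sum.cong)

lemma convex_hull_bary:
  assumes s: "full_simplex s"
  shows "convex hull s = {x. \<forall>v\<in>s. 0 \<le> bary s x v}"
  unfolding convex_hull_finite[OF full_simplex_finite[OF s]]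
  using sum_bary[OF s] bary_combination[OF s] bary_unique[OF s] by fastforce

lemma interior_convex_hull_bary:
  assumes s: "full_simplex s"
  shows "interior (convex hull s) = {x. \<forall>v\<in>s. 0 < bary s x v}"
proof -
  have "\<not> affine_dependent s" "\<not> card s \<le> DIM('a)"
    using s by (auto simp: full_simplex_iff_independent)
  then show ?thesis
    using interior_convex_hull_explicit_minimal[of s]
      sum_bary[OF s] bary_combination[OF s] bary_unique[OF s] by fastforce
qed

text \<open>
  The pivoting step that everything else rests on: solving for \<open>v\<close> in the expression of \<open>p\<close> by the
  vertices shows that \<open>p\<close> may take the place of \<open>v\<close>, and how the coordinates of all points change.
\<close>

lemma
  fixes s :: "'a::euclidean_space set"
  assumes s: "full_simplex s" and v: "v \<in> s" and c: "bary s p v \<noteq> 0"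
  defines "s' \<equiv> insert p (s - {v})"
  shows exchange_vertex_notin: "p \<notin> s - {v}"
    and exchange_vertex_full: "full_simplex s'"
    and exchange_vertex_new: "bary s' x p = bary s x v / bary s p v"
    and exchange_vertex_old: "\<And>u. u \<in> s - {v} \<Longrightarrow>
           bary s' x u = bary s x u - bary s x v * bary s p u / bary s p v"
proof -
  note fin = full_simplex_finite[OF s]
  show np: "p \<notin> s - {v}"
    using bary_vertex[OF s v, of p] c by (auto split: if_splits)
  have ne: "u \<noteq> p" if "u \<in> s - {v}" for u using np that by auto
  let ?b = "\<lambda>x u. if u = p then bary s x v / bary s p v
                 else bary s x u - bary s x v * bary s p u / bary s p v"
  have split: "(\<Sum>u\<in>s. f u) = f v + (\<Sum>u\<in>s-{v}. f u)" for f :: "'a \<Rightarrow> 'b::comm_monoid_add"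
    using sum.remove[OF fin v] .
  have old: "(\<Sum>u\<in>s'. ?b x u) = ?b x p + (\<Sum>u\<in>s-{v}. bary s x u - bary s x v * bary s p u / bary s p v)" for x
  proof -
    have "(\<Sum>u\<in>s'. ?b x u) = ?b x p + (\<Sum>u\<in>s-{v}. ?b x u)"
      unfolding s'_def using np fin by (intro sum.insert) auto
    also have "(\<Sum>u\<in>s-{v}. ?b x u) = (\<Sum>u\<in>s-{v}. bary s x u - bary s x v * bary s p u / bary s p v)"
      by (rule sum.cong[OF refl]) (simp add: ne)
    finally show ?thesis .
  qed
  have old2: "(\<Sum>u\<in>s'. ?b x u *\<^sub>R u) = ?b x p *\<^sub>R p +
      (\<Sum>u\<in>s-{v}. (bary s x u - bary s x v * bary s p u / bary s p v) *\<^sub>R u)" for x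
  proof -
    have "(\<Sum>u\<in>s'. ?b x u *\<^sub>R u) = ?b x p *\<^sub>R p + (\<Sum>u\<in>s-{v}. ?b x u *\<^sub>R u)"
      unfolding s'_def using np fin by (intro sum.insert) auto
    also have "(\<Sum>u\<in>s-{v}. ?b x u *\<^sub>R u) =
        (\<Sum>u\<in>s-{v}. (bary s x u - bary s x v * bary s p u / bary s p v) *\<^sub>R u)"
      by (rule sum.cong[OF refl]) (simp add: ne)
    finally show ?thesis .
  qed
  have rest: "(\<Sum>u\<in>s-{v}. bary s y u) = 1 - bary s y v"
    "(\<Sum>u\<in>s-{v}. bary s y u *\<^sub>R u) = y - bary s y v *\<^sub>R v" for y
    using split[of "bary s y"] split[of "\<lambda>u. bary s y u *\<^sub>R u"] sum_bary[OF s, of y]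
      bary_combination[OF s, of y] by (auto simp: algebra_simps)
  have sum1: "(\<Sum>u\<in>s'. ?b x u) = 1" for x
  proof -
    have "(\<Sum>u\<in>s-{v}. bary s x u - bary s x v * bary s p u / bary s p v)
        = (\<Sum>u\<in>s-{v}. bary s x u) - bary s x v * (\<Sum>u\<in>s-{v}. bary s p u) / bary s p v"
      by (simp add: sum_subtractf sum_distrib_left sum_divide_distrib)
    also have "\<dots> = (1 - bary s x v) - bary s x v * (1 - bary s p v) / bary s p v"
      by (simp only: rest)
    finally show ?thesis using c unfolding old by (simp add: field_simps)
  qed
  have comb: "(\<Sum>u\<in>s'. ?b x u *\<^sub>R u) = x" for x
  proof -
    have "(\<Sum>u\<in>s-{v}. (bary s x u - bary s x v * bary s p u / bary s p v) *\<^sub>R u)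
        = (\<Sum>u\<in>s-{v}. bary s x u *\<^sub>R u) - (bary s x v / bary s p v) *\<^sub>R (\<Sum>u\<in>s-{v}. bary s p u *\<^sub>R u)"
      by (simp add: sum_subtractf scaleR_sum_right algebra_simps)
    also have "\<dots> = (x - bary s x v *\<^sub>R v) - (bary s x v / bary s p v) *\<^sub>R (p - bary s p v *\<^sub>R v)"
      by (simp only: rest)
    finally show ?thesis using c unfolding old2 by (simp add: algebra_simps)
  qed
  have fs': "finite s'" unfolding s'_def using fin by simp
  have "x \<in> affine hull s'" for x
    unfolding affine_hull_finite[OF fs'] using sum1[of x] comb[of x] by blast
  moreover have "card s' = Suc DIM('a)"
    unfolding s'_def using np fin s v by (simp add: full_simplex_def)
  ultimately show full: "full_simplex s'"
    unfolding full_simplex_def by auto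
  show "bary s' x p = bary s x v / bary s p v"
    using bary_unique[OF full sum1 comb, of p x] by (simp add: s'_def)
  show "bary s' x u = bary s x u - bary s x v * bary s p u / bary s p v" if "u \<in> s - {v}" for u
    using bary_unique[OF full sum1 comb, of u x] that np by (auto simp: s'_def)
qed

section \<open>Dissections and star subdivision\<close>

lemma interior_full_simplex_nonempty:
  assumes s: "full_simplex s"
  shows "interior (convex hull s) \<noteq> {}"
proof -
  let ?c = "inverse (real (card s))"
  have pos: "card s > 0" using s by (simp add: full_simplex_def)
  have "bary s (\<Sum>v\<in>s. ?c *\<^sub>R v) w = ?c" if "w \<in> s" for w
    using that pos by (intro bary_unique[OF s]) auto
  then have "(\<Sum>v\<in>s. ?c *\<^sub>R v) \<in> interior (convex hull s)"
    unfolding interior_convex_hull_bary[OF s] using pos by auto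
  then show ?thesis by blast
qed

text \<open>
  The simplices need not meet face to face, since only the interiors have to be disjoint. That is
  enough both for volumes and for half-open counting, and it is easily preserved.
\<close>

definition dissection :: "'a::euclidean_space set set \<Rightarrow> 'a set \<Rightarrow> bool" where
  "dissection T K \<longleftrightarrow> finite T \<and> (\<forall>s\<in>T. full_simplex s) \<and> (\<Union>s\<in>T. convex hull s) = K \<and>
     (\<forall>s\<in>T. \<forall>t\<in>T. s \<noteq> t \<longrightarrow> interior (convex hull s) \<inter> interior (convex hull t) = {})"

lemma dissectionD:
  assumes "dissection T K"
  shows "finite T" "\<And>s. s \<in> T \<Longrightarrow> full_simplex s" "(\<Union>s\<in>T. convex hull s) = K"
    "\<And>s t x. s \<in> T \<Longrightarrow> t \<in> T \<Longrightarrow> x \<in> interior (convex hull s) \<Longrightarrow> x \<in> interior (convex hull t) \<Longrightarrow> s = t"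
    "\<And>s. s \<in> T \<Longrightarrow> convex hull s \<subseteq> K"
  using assms unfolding dissection_def by blast+

lemma dissection_singleton: "full_simplex s \<Longrightarrow> dissection {s} (convex hull s)"
  by (simp add: dissection_def)

text \<open>
  A simplex that occurred in the refinements of two different pieces would have its nonempty
  interior in both of them; so the refinements are disjoint families and their sizes add up.
\<close>

lemma dissection_refine:
  assumes T: "dissection T K" and R: "\<And>s. s \<in> T \<Longrightarrow> dissection (R s) (convex hull s)"
  shows "dissection (\<Union>s\<in>T. R s) K" and "card (\<Union>s\<in>T. R s) = (\<Sum>s\<in>T. card (R s))"
proof -
  have same: "s = s'" if "s \<in> T" "s' \<in> T" "t \<in> R s" "t' \<in> R s'"
      "x \<in> interior (convex hull t)" "x \<in> interior (convex hull t')" for s s' t t' x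
  proof -
    have "x \<in> interior (convex hull s)" "x \<in> interior (convex hull s')"
      using that dissectionD(5)[OF R] interior_mono by blast+
    then show ?thesis using dissectionD(4)[OF T] that by blast
  qed
  show "dissection (\<Union>s\<in>T. R s) K"
    unfolding dissection_def
  proof (intro conjI ballI impI)
    show "finite (\<Union>s\<in>T. R s)" using dissectionD(1)[OF T] dissectionD(1)[OF R] by blast
    show "full_simplex t" if "t \<in> (\<Union>s\<in>T. R s)" for t
      using that dissectionD(2)[OF R] by blast
    show "(\<Union>t\<in>(\<Union>s\<in>T. R s). convex hull t) = K"
      using dissectionD(3)[OF T] dissectionD(3)[OF R] by auto
    fix t t' assume t: "t \<in> (\<Union>s\<in>T. R s)" "t' \<in> (\<Union>s\<in>T. R s)" "t \<noteq> t'"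
    show "interior (convex hull t) \<inter> interior (convex hull t') = {}"
    proof (rule ccontr)
      assume "interior (convex hull t) \<inter> interior (convex hull t') \<noteq> {}"
      then obtain x where x: "x \<in> interior (convex hull t)" "x \<in> interior (convex hull t')" by blast
      obtain s s' where "s \<in> T" "t \<in> R s" "s' \<in> T" "t' \<in> R s'" using t by blast
      with same x have "s = s'" by blast
      then show False
        using dissectionD(4)[OF R] x t \<open>s \<in> T\<close> \<open>t \<in> R s\<close> \<open>t' \<in> R s'\<close> by blast
    qed
  qed
  have "R s \<inter> R s' = {}" if "s \<in> T" "s' \<in> T" "s \<noteq> s'" for s s'
  proof (rule ccontr)
    assume "R s \<inter> R s' \<noteq> {}"
    then obtain t where t: "t \<in> R s" "t \<in> R s'" by blast
    then have "interior (convex hull t) \<noteq> {}"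
      using dissectionD(2)[OF R] that interior_full_simplex_nonempty by blast
    then show False using same t that by blast
  qed
  then show "card (\<Union>s\<in>T. R s) = (\<Sum>s\<in>T. card (R s))"
    using dissectionD(1)[OF T] dissectionD(1)[OF R] by (intro card_UN_disjoint) auto
qed

text \<open>
  For a point \<open>p\<close> of the simplex these are the vertices of the smallest face that contains \<open>p\<close>, so
  that \<open>card (supp s p) - 1\<close> is the dimension of that face.
\<close>

definition supp :: "'a::euclidean_space set \<Rightarrow> 'a \<Rightarrow> 'a set" where
  "supp s p = {v \<in> s. 0 < bary s p v}"

definition star_subdivision :: "'a::euclidean_space set \<Rightarrow> 'a \<Rightarrow> 'a set set" where
  "star_subdivision s p = (\<lambda>v. insert p (s - {v})) ` supp s p"

lemma supp_nonempty:
  assumes "full_simplex s" shows "supp s p \<noteq> {}"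
proof
  assume "supp s p = {}"
  then have "sum (bary s p) s \<le> 0"
    unfolding supp_def by (intro sum_nonpos) force
  then show False using sum_bary[OF assms, of p] by simp
qed

text \<open>
  If the cones over two different facets coincided, the vertex dropped from one of them would have
  to be \<open>p\<close> itself, and \<open>p\<close> is not one of the vertices that are kept.
\<close>

lemma star_subdivision_inj:
  assumes s: "full_simplex s"
  shows "inj_on (\<lambda>v. insert p (s - {v})) (supp s p)"
proof (rule inj_onI, rule ccontr)
  fix v w assume vw: "v \<in> supp s p" "w \<in> supp s p" "insert p (s - {v}) = insert p (s - {w})" "v \<noteq> w"
  then have "w \<in> insert p (s - {w})" by (auto simp: supp_def)
  then have "w = p" by simp
  then show False using exchange_vertex_notin[OF s, of v p] vw by (auto simp: supp_def)
qed

lemma card_star_subdivision: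
  "full_simplex s \<Longrightarrow> card (star_subdivision s p) = card (supp s p)"
  unfolding star_subdivision_def using card_image[OF star_subdivision_inj] .

text \<open>
  The ratio test of the simplex method: of the vertices with a positive coordinate of \<open>p\<close>, remove
  one with the least ratio of the coordinate of \<open>x\<close> to that of \<open>p\<close>. Then no new coordinate of \<open>x\<close> is
  negative. The point \<open>p\<close> may lie outside of the simplex; this generality serves the construction of
  triangulations below.
\<close>

lemma star_subdivision_cover:
  assumes s: "full_simplex s" and x: "x \<in> convex hull s"
  shows "\<exists>v\<in>supp s p. x \<in> convex hull (insert p (s - {v}))"
proof -
  note fin = full_simplex_finite[OF s]
  let ?r = "\<lambda>v. bary s x v / bary s p v"
  have "finite (supp s p)" "supp s p \<noteq> {}"
    using fin supp_nonempty[OF s] by (auto simp: supp_def)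
  then obtain v where v: "v \<in> supp s p" and min: "\<And>u. u \<in> supp s p \<Longrightarrow> ?r v \<le> ?r u"
    using ex_is_arg_min_if_finite[of "supp s p" ?r] unfolding is_arg_min_linorder by blast
  have vs: "v \<in> s" and c: "0 < bary s p v" using v by (auto simp: supp_def)
  have cn: "bary s p v \<noteq> 0" using c by simp
  have "0 \<le> bary (insert p (s - {v})) x u" if "u \<in> insert p (s - {v})" for u
  proof (cases "u = p")
    case True
    then show ?thesis
      using exchange_vertex_new[OF s vs cn, of x] c x vs by (simp add: convex_hull_bary[OF s])
  next
    case False
    then have u: "u \<in> s - {v}" using that by simp
    have px: "0 \<le> bary s x u" "0 \<le> bary s x v"
      using x u vs by (auto simp: convex_hull_bary[OF s])
    have "bary s x v * bary s p u / bary s p v \<le> bary s x u"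
    proof (cases "bary s p u \<le> 0")
      case True
      then have "bary s x v * bary s p u / bary s p v \<le> 0"
        using px(2) c by (simp add: divide_nonpos_pos mult_nonneg_nonpos)
      then show ?thesis using px(1) by simp
    next
      case False
      then have "u \<in> supp s p" using u by (simp add: supp_def)
      from min[OF this] show ?thesis using px False c by (simp add: field_simps)
    qed
    then show ?thesis using exchange_vertex_old[OF s vs cn u, of x] by simp
  qed
  then show ?thesis
    using v convex_hull_bary[OF exchange_vertex_full[OF s vs cn]] by blast
qed

lemma dissection_star_subdivision:
  assumes s: "full_simplex s" and p: "p \<in> convex hull s"
  shows "dissection (star_subdivision s p) (convex hull s)"
  unfolding dissection_def
proof (intro conjI ballI impI)
  show "finite (star_subdivision s p)"
    using full_simplex_finite[OF s] by (simp add: star_subdivision_def supp_def)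
  show "full_simplex t" if "t \<in> star_subdivision s p" for t
    using that exchange_vertex_full[OF s, of _ p] by (auto simp: star_subdivision_def supp_def)
  have sub: "convex hull (insert p (s - {v})) \<subseteq> convex hull s" for v
    using p by (intro hull_minimal) (auto intro: hull_inc)
  show "(\<Union>t\<in>star_subdivision s p. convex hull t) = convex hull s"
  proof
    show "(\<Union>t\<in>star_subdivision s p. convex hull t) \<subseteq> convex hull s"
      unfolding star_subdivision_def by (rule UN_least) (use sub in auto)
    show "convex hull s \<subseteq> (\<Union>t\<in>star_subdivision s p. convex hull t)"
      using star_subdivision_cover[OF s, of _ p] by (auto simp: star_subdivision_def)
  qed
  fix t t' assume t: "t \<in> star_subdivision s p" "t' \<in> star_subdivision s p" "t \<noteq> t'"
  then obtain v w where v: "v \<in> s" "0 < bary s p v" "t = insert p (s - {v})"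
    and w: "w \<in> s" "0 < bary s p w" "t' = insert p (s - {w})" and "v \<noteq> w"
    by (auto simp: star_subdivision_def supp_def)
  have ft: "full_simplex t" "full_simplex t'"
    using exchange_vertex_full[OF s v(1), of p] exchange_vertex_full[OF s w(1), of p] v w by simp_all
  show "interior (convex hull t) \<inter> interior (convex hull t') = {}"
  proof (rule ccontr)
    assume "interior (convex hull t) \<inter> interior (convex hull t') \<noteq> {}"
    then obtain x where x: "\<And>u. u \<in> t \<Longrightarrow> 0 < bary t x u" "\<And>u. u \<in> t' \<Longrightarrow> 0 < bary t' x u"
      unfolding interior_convex_hull_bary[OF ft(1)] interior_convex_hull_bary[OF ft(2)] by auto
    have "0 < bary s x w - bary s x v * bary s p w / bary s p v"
      using x(1)[of w] exchange_vertex_old[OF s v(1), of p w x] v w \<open>v \<noteq> w\<close> by simp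
    moreover have "0 < bary s x v - bary s x w * bary s p v / bary s p w"
      using x(2)[of v] exchange_vertex_old[OF s w(1), of p v x] v w \<open>v \<noteq> w\<close> by simp
    ultimately show False using v(2) w(2) by (simp add: field_simps)
  qed
qed

text \<open>
  A simplex that does not contain \<open>p\<close> stays as it is, and one that has \<open>p\<close> as a vertex is its own
  star subdivision.
\<close>

definition insert_point :: "'a::euclidean_space set set \<Rightarrow> 'a \<Rightarrow> 'a set set" where
  "insert_point T p = (\<Union>s\<in>T. if p \<in> convex hull s then star_subdivision s p else {s})"

lemma
  assumes T: "dissection T K"
  shows dissection_insert_point: "dissection (insert_point T p) K"
    and card_insert_point: "card (insert_point T p) =
          card T + (\<Sum>s\<in>{s \<in> T. p \<in> convex hull s}. card (supp s p) - 1)"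
proof -
  let ?R = "\<lambda>s. if p \<in> convex hull s then star_subdivision s p else {s}"
  have R: "dissection (?R s) (convex hull s)" if "s \<in> T" for s
    using dissection_star_subdivision dissection_singleton dissectionD(2)[OF T that] by auto
  show "dissection (insert_point T p) K"
    unfolding insert_point_def by (rule dissection_refine(1)[OF T R])
  have "card (insert_point T p) = (\<Sum>s\<in>T. card (?R s))"
    unfolding insert_point_def by (rule dissection_refine(2)[OF T R])
  also have "\<dots> = (\<Sum>s\<in>T. 1 + (if p \<in> convex hull s then card (supp s p) - 1 else 0))"
  proof (rule sum.cong[OF refl])
    fix s assume "s \<in> T"
    then have s: "full_simplex s" using dissectionD(2)[OF T] by blast
    have "card (supp s p) > 0"
      using supp_nonempty[OF s] full_simplex_finite[OF s] by (simp add: card_gt_0_iff supp_def)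
    then show "card (?R s) = 1 + (if p \<in> convex hull s then card (supp s p) - 1 else 0)"
      using card_star_subdivision[OF s] by simp
  qed
  also have "\<dots> = card T + (\<Sum>s\<in>T. if p \<in> convex hull s then card (supp s p) - 1 else 0)"
    by (simp add: sum.distrib del: One_nat_def flip: card_eq_sum)
  also have "(\<Sum>s\<in>T. if p \<in> convex hull s then card (supp s p) - 1 else 0)
      = (\<Sum>s\<in>{s \<in> T. p \<in> convex hull s}. card (supp s p) - 1)"
    by (rule sum.inter_filter[OF dissectionD(1)[OF T], symmetric])
  finally show "card (insert_point T p) =
      card T + (\<Sum>s\<in>{s \<in> T. p \<in> convex hull s}. card (supp s p) - 1)" .
qed

lemma Union_insert_point: "\<Union>(insert_point T p) \<subseteq> insert p (\<Union>T)"
  by (auto simp: insert_point_def star_subdivision_def split: if_splits)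

section \<open>How many simplices meet at an interior point\<close>

text \<open>
  Greedy choice: as long as the vectors chosen so far span less than \<open>card (\<Phi> i)\<close> dimensions, some
  member of the independent set \<open>\<Phi> i\<close> is outside of their span.
\<close>

lemma independent_selection:
  fixes \<Phi> :: "'i \<Rightarrow> 'a::euclidean_space set"
  assumes "finite I" "independent B"
    "\<And>i. i \<in> I \<Longrightarrow> independent (\<Phi> i)" "\<And>i. i \<in> I \<Longrightarrow> card B + card I \<le> card (\<Phi> i)"
  shows "\<exists>f. (\<forall>i\<in>I. f i \<in> \<Phi> i) \<and> independent (B \<union> f ` I)"
  using assms
proof (induction I arbitrary: B rule: finite_induct)
  case empty
  then show ?case by simp
next
  case (insert i I)
  have "\<not> \<Phi> i \<subseteq> span B"
  proof
    assume "\<Phi> i \<subseteq> span B"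
    then have "card (\<Phi> i) \<le> card B"
      using independent_span_bound[OF independent_imp_finite[OF insert.prems(1)] insert.prems(2)] by simp
    moreover have "card B + Suc (card I) \<le> card (\<Phi> i)"
      using insert.prems(3)[of i] insert.hyps by simp
    ultimately show False by simp
  qed
  then obtain g where g: "g \<in> \<Phi> i" "g \<notin> span B" by blast
  have gB: "g \<notin> B" using g span_base by blast
  have "\<exists>f. (\<forall>j\<in>I. f j \<in> \<Phi> j) \<and> independent (insert g B \<union> f ` I)"
  proof (rule insert.IH)
    show "independent (insert g B)" using g insert.prems(1) by (simp add: independent_insertI)
    show "card (insert g B) + card I \<le> card (\<Phi> j)" if "j \<in> I" for j
      using insert.prems(3)[of j] that insert.hyps gB independent_imp_finite[OF insert.prems(1)] by simp
  qed (use insert.prems in auto)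
  then obtain f where f: "\<forall>j\<in>I. f j \<in> \<Phi> j" "independent (insert g B \<union> f ` I)" by blast
  have "(f(i := g)) ` insert i I = insert g (f ` I)"
    using insert.hyps by auto
  then have "independent (B \<union> (f(i := g)) ` insert i I)" using f(2) by simp
  then show ?case using f(1) g(1) by (intro exI[of _ "f(i := g)"]) auto
qed

lemma independent_common_negative:
  fixes C :: "'a::euclidean_space set"
  assumes "independent C"
  shows "\<exists>d. \<forall>c\<in>C. c \<bullet> d < 0"
proof -
  obtain g :: "'a \<Rightarrow> real" where g: "linear g" "\<forall>c\<in>C. g c = -1"
    using linear_independent_extend[OF assms, of "\<lambda>_. -1"] by blast
  have "c \<bullet> adjoint g 1 = g c" for c
    using adjoint_works[OF g(1), of c 1] by simp
  then show ?thesis using g(2) by (intro exI[of _ "adjoint g 1"]) simp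
qed

text \<open>
  A barycentric coordinate is an affine function of the point; this is its gradient, an inner normal
  vector of the facet opposite to \<open>v\<close>.
\<close>

definition bary_grad :: "'a::euclidean_space set \<Rightarrow> 'a \<Rightarrow> 'a" where
  "bary_grad s v = (SOME a. \<forall>x y. bary s x v = bary s y v + a \<bullet> (x - y))"

lemma bary_grad:
  assumes s: "full_simplex s" and v: "v \<in> s"
  shows "bary s x v = bary s y v + bary_grad s v \<bullet> (x - y)"
proof -
  let ?h = "\<lambda>d. bary s d v - bary s 0 v"
  have comb: "bary s (a *\<^sub>R x + b *\<^sub>R y) v = a * bary s x v + b * bary s y v + (1 - a - b) * bary s 0 v"
    for a b x y
  proof -
    have "bary s (\<Sum>i\<in>{0,1,2::nat}. (if i = 0 then a else if i = 1 then b else 1 - a - b) *\<^sub>R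
             (if i = 0 then x else if i = 1 then y else 0)) v
      = (\<Sum>i\<in>{0,1,2::nat}. (if i = 0 then a else if i = 1 then b else 1 - a - b) *
             bary s (if i = 0 then x else if i = 1 then y else 0) v)"
      by (rule bary_affine[OF s _ _ v]) auto
    then show ?thesis by simp
  qed
  have lin: "linear ?h"
  proof (rule linearI)
    show "?h (x + y) = ?h x + ?h y" for x y
      using comb[of 1 x 1 y] by simp
    show "?h (c *\<^sub>R x) = c *\<^sub>R ?h x" for c x
      using comb[of c x 0 0] by (simp add: algebra_simps)
  qed
  have "\<forall>x y. bary s x v = bary s y v + adjoint ?h 1 \<bullet> (x - y)"
  proof (intro allI)
    fix x y
    have "adjoint ?h 1 \<bullet> (x - y) = ?h (x - y)"
      using adjoint_works[OF lin, of "x - y" 1] by (simp add: inner_commute)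
    also have "\<dots> = ?h x - ?h y" by (rule linear_diff[OF lin])
    finally show "bary s x v = bary s y v + adjoint ?h 1 \<bullet> (x - y)" by simp
  qed
  then have "\<forall>x y. bary s x v = bary s y v + bary_grad s v \<bullet> (x - y)"
    unfolding bary_grad_def by (rule someI)
  then show ?thesis by blast
qed

text \<open>
  The gradients at a set of vertices that omits \<open>z\<close> form a dual basis to the edge vectors from \<open>z\<close>
  to these vertices.
\<close>

lemma bary_grad_independent:
  assumes s: "full_simplex s" and A: "A \<subseteq> s" "z \<in> s" "z \<notin> A"
  shows "inj_on (bary_grad s) A" and "independent (bary_grad s ` A)"
proof -
  have dual: "bary_grad s v \<bullet> (w - z) = (if v = w then 1 else 0)" if "v \<in> A" "w \<in> A" for v w
  proof -
    have "v \<in> s" "w \<in> s" "v \<noteq> z" using that A by auto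
    then show ?thesis
      using bary_grad[OF s, of v w z] bary_vertex[OF s, of v w] bary_vertex[OF s, of v z] A(2) by simp
  qed
  show inj: "inj_on (bary_grad s) A"
    using dual by (intro inj_onI) (metis zero_neq_one)
  have fin: "finite A" using full_simplex_finite[OF s] A finite_subset by blast
  show "independent (bary_grad s ` A)"
  proof (rule independent_if_scalars_zero)
    fix f x assume sum0: "(\<Sum>x\<in>bary_grad s ` A. f x *\<^sub>R x) = 0" and "x \<in> bary_grad s ` A"
    then obtain w where w: "w \<in> A" "x = bary_grad s w" by blast
    have "0 = (\<Sum>v\<in>A. f (bary_grad s v) *\<^sub>R bary_grad s v) \<bullet> (w - z)"
      using sum0 by (simp add: sum.reindex[OF inj])
    also have "\<dots> = (\<Sum>v\<in>A. f (bary_grad s v) * (if v = w then 1 else 0))"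
      unfolding inner_sum_left by (rule sum.cong) (use dual w in auto)
    also have "\<dots> = f x" using w by (simp add: sum.remove[OF fin w(1)])
    finally show "f x = 0" by simp
  qed (use fin in simp)
qed

text \<open>
  The tangent cones at \<open>p\<close> of the simplices that contain \<open>p\<close> cover the whole space: a short step
  from \<open>p\<close> in direction \<open>d\<close> stays in \<open>K\<close>, and one of the finitely many simplices contains
  arbitrarily short steps, hence, being closed, also \<open>p\<close>.
\<close>

lemma directions_covered:
  assumes T: "dissection T K" and p: "p \<in> interior K"
  shows "\<exists>s\<in>T. p \<in> convex hull s \<and> (\<forall>v\<in>s. bary s p v = 0 \<longrightarrow> 0 \<le> bary_grad s v \<bullet> d)"
proof -
  have lim: "((\<lambda>t. p + t *\<^sub>R d) \<longlongrightarrow> p) (at_right (0::real))"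
    by (auto intro!: tendsto_eq_intros)
  have "\<forall>\<^sub>F t in at_right (0::real). p + t *\<^sub>R d \<in> interior K"
    using topological_tendstoD[OF lim open_interior p] .
  then have "\<forall>\<^sub>F t in at_right (0::real). \<exists>s\<in>T. p + t *\<^sub>R d \<in> convex hull s"
    by (rule eventually_mono) (use dissectionD(3)[OF T] interior_subset in blast)
  then have "\<exists>\<^sub>F t in at_right (0::real). \<exists>s\<in>T. p + t *\<^sub>R d \<in> convex hull s"
    by (rule eventually_frequently[rotated]) simp
  then have "\<exists>s\<in>T. \<exists>\<^sub>F t in at_right (0::real). p + t *\<^sub>R d \<in> convex hull s"
    by (rule frequently_bex_finite[OF dissectionD(1)[OF T]])
  then obtain s where s: "s \<in> T" and fr: "\<exists>\<^sub>F t in at_right (0::real). p + t *\<^sub>R d \<in> convex hull s"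
    by blast
  note full = dissectionD(2)[OF T s]
  have "p \<in> convex hull s"
  proof (rule ccontr)
    assume "p \<notin> convex hull s"
    moreover have "closed (convex hull s)"
      using full_simplex_finite[OF full] by (simp add: compact_imp_closed finite_imp_compact_convex_hull)
    ultimately have "\<forall>\<^sub>F t in at_right (0::real). p + t *\<^sub>R d \<in> - (convex hull s)"
      by (intro topological_tendstoD[OF lim]) auto
    then show False using fr by (simp add: frequently_def)
  qed
  moreover have "0 \<le> bary_grad s v \<bullet> d" if v: "v \<in> s" "bary s p v = 0" for v
  proof -
    have "\<exists>\<^sub>F t in at_right (0::real). p + t *\<^sub>R d \<in> convex hull s \<and> 0 < t"
      unfolding conj_commute[of "_ \<in> _"]
      using frequently_eventually_conj[OF fr eventually_at_right_less] by simp
    then obtain t where t: "p + t *\<^sub>R d \<in> convex hull s" "0 < t"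
      by (metis (no_types, lifting) frequently_ex)
    have "0 \<le> bary s (p + t *\<^sub>R d) v" using t v by (simp add: convex_hull_bary[OF full])
    also have "\<dots> = t * (bary_grad s v \<bullet> d)"
      using bary_grad[OF full v(1), of "p + t *\<^sub>R d" p] v by simp
    finally show ?thesis using t by (simp add: zero_le_mult_iff)
  qed
  ultimately show ?thesis using s by blast
qed

text \<open>
  A point of the simplex with a single positive coordinate is a vertex.
\<close>

lemma card_supp_ge_2:
  assumes s: "full_simplex s" and p: "p \<in> convex hull s" "p \<notin> s"
  shows "2 \<le> card (supp s p)"
proof (rule ccontr)
  assume "\<not> 2 \<le> card (supp s p)"
  moreover have "0 < card (supp s p)"
    using supp_nonempty[OF s] full_simplex_finite[OF s] by (simp add: card_gt_0_iff supp_def)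
  ultimately have "card (supp s p) = 1" by simp
  then obtain v where v: "supp s p = {v}" using card_1_singletonE by blast
  have vs: "v \<in> s" using v by (auto simp: supp_def)
  have z: "bary s p u = 0" if "u \<in> s - {v}" for u
    using v that p(1) by (force simp: supp_def convex_hull_bary[OF s])
  have "(\<Sum>u\<in>s. bary s p u *\<^sub>R u) = bary s p v *\<^sub>R v + (\<Sum>u\<in>s-{v}. bary s p u *\<^sub>R u)"
    "(\<Sum>u\<in>s. bary s p u) = bary s p v + (\<Sum>u\<in>s-{v}. bary s p u)"
    using sum.remove[OF full_simplex_finite[OF s] vs] by auto
  then have "p = v" using z sum_bary[OF s, of p] bary_combination[OF s, of p] by simp
  then show False using p vs by simp
qed

text \<open>
  Let \<open>j\<close> be the dimension of the face of \<open>s\<close> that has \<open>p\<close> in its relative interior. The tangent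
  cone of \<open>s\<close> at \<open>p\<close> is cut out by \<open>n - j\<close> independent linear inequalities. If one inequality could
  be picked for every simplex of the star so that all the picked ones are independent, some
  direction would violate all of them and leave the star, contradicting \<open>directions_covered\<close>. By
  greedy selection this happens whenever \<open>m + j \<le> n\<close> for all \<open>m\<close> simplices of the star. So
  \<open>m + j \<ge> n + 1\<close> for one of them, and the other \<open>m - 1\<close> simplices contribute at least \<open>1\<close> each to
  the sum.

  If the sum is \<open>n\<close>, the others contribute exactly \<open>1\<close> each and \<open>m + j = n + 1\<close>. An intermediate
  value \<open>1 < j < n\<close> is then impossible: start the greedy selection with the exceptional simplex,
  which has at least one inequality; the others have \<open>n - 1 \<ge> m\<close> each.
\<close>

lemma
  fixes T :: "'a::euclidean_space set set"
  assumes T: "dissection T K" and p: "p \<in> interior K" "p \<notin> \<Union>T"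
  defines "A \<equiv> {s \<in> T. p \<in> convex hull s}"
  shows star_increment_ge: "DIM('a) \<le> (\<Sum>s\<in>A. card (supp s p) - 1)"
    and star_increment_eq: "(\<Sum>s\<in>A. card (supp s p) - 1) = DIM('a) \<Longrightarrow>
          \<forall>s\<in>A. card (supp s p) - 1 \<in> {1, DIM('a)}"
proof -
  let ?j = "\<lambda>s. card (supp s p) - 1"
  define \<Phi> where "\<Phi> = (\<lambda>s. bary_grad s ` (s - supp s p))"
  have fin: "finite A" using dissectionD(1)[OF T] by (simp add: A_def)
  have full: "full_simplex s" "p \<in> convex hull s" "p \<notin> s" if "s \<in> A" for s
    using that dissectionD(2)[OF T] p by (auto simp: A_def)
  have j1: "1 \<le> ?j s" if "s \<in> A" for s
    using card_supp_ge_2[OF full[OF that]] by simp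
  have sub: "supp s p \<subseteq> s" for s by (auto simp: supp_def)
  have ind: "independent (\<Phi> s)" and card: "card (\<Phi> s) = DIM('a) - ?j s" "?j s \<le> DIM('a)" if sA: "s \<in> A" for s
  proof -
    obtain z where z: "z \<in> supp s p" using supp_nonempty[OF full(1)[OF sA]] by blast
    note gi = bary_grad_independent[OF full(1)[OF sA], of "s - supp s p" z]
    show "independent (\<Phi> s)" unfolding \<Phi>_def using gi(2) z sub by blast
    have fs: "finite s" using full_simplex_finite[OF full(1)[OF sA]] .
    then have fsupp: "finite (supp s p)" using sub finite_subset by blast
    have "card (\<Phi> s) = card (s - supp s p)"
      unfolding \<Phi>_def using gi(1) z sub by (intro card_image) blast
    also have "\<dots> = card s - card (supp s p)" using card_Diff_subset[OF fsupp sub] .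
    finally show "card (\<Phi> s) = DIM('a) - ?j s"
      using full(1)[OF sA] j1[OF sA] by (simp add: full_simplex_def)
    have "card (supp s p) \<le> card s" using card_mono[OF fs sub] .
    then show "?j s \<le> DIM('a)" using full(1)[OF sA] by (simp add: full_simplex_def)
  qed
  have no_escape: False if f: "\<forall>s\<in>A. f s \<in> \<Phi> s" "independent (f ` A)" for f
  proof -
    obtain d where d: "\<forall>c\<in>f ` A. c \<bullet> d < 0" using independent_common_negative[OF f(2)] by blast
    obtain s where s: "s \<in> A" "\<forall>v\<in>s. bary s p v = 0 \<longrightarrow> 0 \<le> bary_grad s v \<bullet> d"
      using directions_covered[OF T p(1), of d] by (auto simp: A_def)
    obtain v where v: "v \<in> s - supp s p" "f s = bary_grad s v" using f s by (auto simp: \<Phi>_def)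
    have "bary s p v = 0"
      using v(1) full(2)[OF s(1)] by (force simp: supp_def convex_hull_bary[OF full(1)[OF s(1)]])
    then show False using s d v by force
  qed
  have "\<exists>s\<in>A. DIM('a) < card A + ?j s"
  proof (rule ccontr)
    assume "\<not> (\<exists>s\<in>A. DIM('a) < card A + ?j s)"
    then have "\<And>s. s \<in> A \<Longrightarrow> card {} + card A \<le> card (\<Phi> s)"
      using card by (metis (no_types, lifting) add.left_neutral add_le_imp_le_diff card.empty not_less)
    then obtain f where "\<forall>s\<in>A. f s \<in> \<Phi> s" "independent ({} \<union> f ` A)"
      using independent_selection[OF fin independent_empty, of \<Phi>] ind by blast
    then show False using no_escape by simp
  qed
  then obtain s0 where s0: "s0 \<in> A" "DIM('a) < card A + ?j s0" by blast
  have split: "(\<Sum>s\<in>A. ?j s) = ?j s0 + (\<Sum>s\<in>A-{s0}. ?j s)"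
    using sum.remove[OF fin s0(1)] .
  have rest: "(\<Sum>s\<in>A-{s0}. ?j s) = (card A - 1) + (\<Sum>s\<in>A-{s0}. ?j s - 1)"
  proof -
    have "(\<Sum>s\<in>A-{s0}. ?j s) = (\<Sum>s\<in>A-{s0}. 1 + (?j s - 1))"
      by (rule sum.cong[OF refl]) (metis DiffD1 j1 le_add_diff_inverse)
    also have "\<dots> = card (A - {s0}) + (\<Sum>s\<in>A-{s0}. ?j s - 1)"
      unfolding sum.distrib by simp
    finally show ?thesis using s0 fin by simp
  qed
  have cA: "card A \<ge> 1" using s0 fin by (metis card_0_eq empty_iff less_one not_less)
  show "DIM('a) \<le> (\<Sum>s\<in>A. ?j s)" using split rest s0(2) cA by linarith
  assume eq: "(\<Sum>s\<in>A. ?j s) = DIM('a)"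
  have "(\<Sum>s\<in>A-{s0}. ?j s - 1) = 0" and cardA: "card A + ?j s0 = DIM('a) + 1"
    using split rest s0(2) cA eq by linarith+
  then have others: "?j s = 1" if "s \<in> A - {s0}" for s
  proof -
    have "?j s - 1 = 0"
      using \<open>(\<Sum>s\<in>A-{s0}. ?j s - 1) = 0\<close> that fin by (simp add: sum_eq_0_iff del: diff_is_0_eq)
    then show ?thesis using that j1[of s] by simp
  qed
  have "?j s0 \<in> {1, DIM('a)}"
  proof (rule ccontr)
    assume "?j s0 \<notin> {1, DIM('a)}"
    then have j0: "2 \<le> ?j s0" "?j s0 < DIM('a)" using j1[OF s0(1)] card(2)[OF s0(1)] by auto
    then have "card (\<Phi> s0) \<noteq> 0" using card(1)[OF s0(1)] by simp
    then obtain g where g: "g \<in> \<Phi> s0" by (metis card.empty ex_in_conv)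
    then have "g \<noteq> 0" using ind[OF s0(1)] dependent_zero by blast
    then have ig: "independent {g}" by simp
    have "\<And>s. s \<in> A - {s0} \<Longrightarrow> card {g} + card (A - {s0}) \<le> card (\<Phi> s)"
      using others card(1) cardA j0 s0 fin cA by simp
    then obtain f where f: "\<forall>s\<in>A-{s0}. f s \<in> \<Phi> s" "independent ({g} \<union> f ` (A - {s0}))"
      using independent_selection[OF _ ig, of "A - {s0}" \<Phi>] ind fin by blast
    have im: "(f(s0 := g)) ` A = {g} \<union> f ` (A - {s0})" using s0 by auto
    have mem: "\<forall>s\<in>A. (f(s0 := g)) s \<in> \<Phi> s" using f(1) g by auto
    show False by (rule no_escape[OF mem]) (use im f(2) in argo)
  qed
  then show "\<forall>s\<in>A. ?j s \<in> {1, DIM('a)}" using others by blast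
qed

section \<open>Volumes of lattice simplices\<close>

text \<open>
  The usual reduction to elementary linear maps, carried out for an index type without an order: the
  determinants of a transposition and of a shear are found from \<open>h \<circ> h = id\<close> and from a row
  operation, not from a triangular shape.
\<close>

lemma measure_linear_image_det:
  fixes f :: "real^'n \<Rightarrow> real^'n"
  assumes "linear f" "S \<in> lmeasurable"
  shows "f ` S \<in> lmeasurable \<and> measure lebesgue (f ` S) = \<bar>det (matrix f)\<bar> * measure lebesgue S"
proof -
  define Q :: "(real^'n \<Rightarrow> real^'n) \<Rightarrow> bool" where
    "Q h \<longleftrightarrow> (\<forall>S\<in>lmeasurable. h ` S \<in> lmeasurable \<and>
       measure lebesgue (h ` S) = \<bar>det (matrix h)\<bar> * measure lebesgue S)" for h
  have "Q f"
  proof (rule induct_linear_elementary[OF assms(1)])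
    fix f g :: "real^'n \<Rightarrow> real^'n"
    assume 1: "linear f" "linear g" "Q f" "Q g"
    show "Q (f \<circ> g)"
      unfolding Q_def
    proof
      fix S :: "(real^'n) set" assume S: "S \<in> lmeasurable"
      have "(f \<circ> g) ` S = f ` g ` S" by (rule image_comp[symmetric])
      moreover have "g ` S \<in> lmeasurable" using 1(4) S by (simp add: Q_def)
      ultimately show "(f \<circ> g) ` S \<in> lmeasurable \<and>
          measure lebesgue ((f \<circ> g) ` S) = \<bar>det (matrix (f \<circ> g))\<bar> * measure lebesgue S"
        using matrix_compose[OF 1(2,1)] 1(3,4) S by (simp only: Q_def det_mul abs_mult mult.assoc)
    qed
  next
    fix f :: "real^'n \<Rightarrow> real^'n" and i
    assume 2: "linear f" "\<And>x. f x $ i = 0"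
    have "\<not> surj f"
    proof
      assume "surj f"
      then obtain x where "f x = axis i 1" by (metis surjD)
      then show False using 2(2)[of x] by simp
    qed
    then have "\<not> inj f" using linear_injective_imp_surjective[OF 2(1)] by blast
    then have "\<And>S. negligible (f ` S)" "det (matrix f) = 0"
      using negligible_linear_singular_image[OF 2(1)] det_nz_iff_inj[OF 2(1)] by auto
    then show "Q f" by (simp add: Q_def negligible_imp_measurable negligible_imp_measure0)
  next
    fix c :: "'n \<Rightarrow> real"
    have "matrix (\<lambda>x. \<chi> i. c i * x $ i) = (\<chi> i j. if i = j then c i else (0::real))"
      by (auto simp: matrix_def axis_def vec_eq_iff)
    moreover have "det (\<chi> i j. if i = j then c i else (0::real)) = prod c UNIV"
      by (subst det_diagonal) auto
    ultimately show "Q (\<lambda>x. \<chi> i. c i * x $ i)"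
      using measurable_stretch[of _ c] measure_stretch[of _ c] by (simp add: Q_def)
  next
    fix m k :: 'n
    let ?h = "\<lambda>x :: real^'n. \<chi> i. x $ Transposition.transpose m k i"
    have lin: "linear ?h" by (rule linearI) (simp_all add: vec_eq_iff)
    have "?h \<circ> ?h = id" by (rule ext) (simp add: vec_eq_iff)
    then have "det (matrix ?h) * det (matrix ?h) = 1"
      using matrix_compose[OF lin lin] by (metis det_mul det_I matrix_id_mat_1)
    then have det: "\<bar>det (matrix ?h)\<bar> = 1"
      by (metis abs_square_eq_1 power2_eq_square)
    have meq: "measure lebesgue (?h ` cbox a b) = 1 * measure lebesgue (cbox a b)" for a b
    proof (cases "cbox a b = {}")
      case False
      have inv: "?h (?h x) = x" for x by (simp add: vec_eq_iff)
      have eq: "?h ` cbox a b = cbox (?h a) (?h b)"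
      proof (intro set_eqI iffI)
        fix x assume "x \<in> cbox (?h a) (?h b)"
        then have "?h x \<in> cbox a b"
          unfolding mem_box_cart by (metis transpose_involutory vec_lambda_beta)
        then show "x \<in> ?h ` cbox a b" using inv[of x] by (metis imageI)
      qed (auto simp: mem_box_cart)
      then have ne: "cbox (?h a) (?h b) \<noteq> {}" using False by auto
      have "(\<Prod>i\<in>UNIV. ?h b $ i - ?h a $ i) = (\<Prod>i\<in>UNIV. b $ i - a $ i)"
        using prod.reindex_bij_betw[of "Transposition.transpose m k" UNIV UNIV "\<lambda>i. b $ i - a $ i"]
          bij_transpose[of m k] by simp
      then show ?thesis using content_cbox_cart[OF ne] content_cbox_cart[OF False] by (simp add: eq)
    qed simp
    show "Q ?h"
      unfolding Q_def
    proof
      fix S :: "(real^'n) set" assume "S \<in> lmeasurable"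
      from measure_linear_sufficient[OF lin this meq]
      show "?h ` S \<in> lmeasurable \<and> measure lebesgue (?h ` S) = \<bar>det (matrix ?h)\<bar> * measure lebesgue S"
        by (simp only: det abs_one)
    qed
  next
    fix m k :: 'n assume 5: "m \<noteq> k"
    let ?h = "\<lambda>x :: real^'n. \<chi> i. if i = m then x $ m + x $ k else x $ i"
    have lin: "linear ?h" by (rule linearI) (auto simp: vec_eq_iff algebra_simps)
    have "matrix ?h = (\<chi> i. if i = m then row m (mat 1) + 1 *s row k (mat 1) else row i (mat 1))"
      by (auto simp: matrix_def vec_eq_iff row_def mat_def axis_def)
    then have det: "det (matrix ?h) = 1" using det_row_operation[OF 5, of "mat 1" 1] by simp
    have meq: "measure lebesgue (?h ` cbox a b) = 1 * measure lebesgue (cbox a b)" for a b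
    proof (cases "cbox a b = {}")
      case False
      \<comment> \<open>Translate the box so that its \<open>k\<close>-th coordinates are nonnegative, as \<open>measure_shear_interval\<close> demands.\<close>
      let ?c = "axis k \<bar>a $ k\<bar> :: real^'n"
      have ne: "cbox (?c + a) (?c + b) \<noteq> {}" using False cbox_translation[of ?c a b] by auto
      have nonneg: "0 \<le> (?c + a) $ k" by simp
      have "?h ` cbox (?c + a) (?c + b) = (+) (?h ?c) ` (?h ` cbox a b)"
        unfolding cbox_translation image_image using linear_add[OF lin] by auto
      then have "measure lebesgue (?h ` cbox a b) = measure lebesgue (?h ` cbox (?c + a) (?c + b))"
        by (simp only: measure_translation)
      also have "\<dots> = measure lebesgue (cbox (?c + a) (?c + b))"
        by (rule measure_shear_interval[OF 5 ne nonneg])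
      also have "\<dots> = measure lebesgue (cbox a b)"
        unfolding cbox_translation by (rule measure_translation)
      finally show ?thesis by simp
    qed simp
    show "Q ?h"
      unfolding Q_def
    proof
      fix S :: "(real^'n) set" assume "S \<in> lmeasurable"
      from measure_linear_sufficient[OF lin this meq]
      show "?h ` S \<in> lmeasurable \<and> measure lebesgue (?h ` S) = \<bar>det (matrix ?h)\<bar> * measure lebesgue S"
        by (simp only: det abs_one)
    qed
  qed
  then show ?thesis using assms(2) by (simp add: Q_def)
qed

definition edge_matrix :: "('n \<Rightarrow> real^'n) \<Rightarrow> real^'n \<Rightarrow> real^'n^'n" where
  "edge_matrix f z = (\<chi> i j. f j $ i - z $ i)"

lemma edge_matrix_mult: "edge_matrix f z *v x = (\<Sum>j\<in>UNIV. x $ j *\<^sub>R (f j - z))"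
  by (simp add: edge_matrix_def matrix_vector_mult_def vec_eq_iff mult.commute)

lemma measure_simplex:
  fixes s :: "(real^'n) set"
  assumes s: "full_simplex s" and z: "z \<in> s" and f: "bij_betw f UNIV (s - {z})"
  shows "measure lebesgue (convex hull s) = \<bar>det (edge_matrix f z)\<bar> / fact CARD('n)"
proof -
  let ?g = "(*v) (edge_matrix f z)" and ?std = "convex hull (insert 0 Basis :: (real^'n) set)"
  have [simp]: "?g (axis i 1) = f i - z" for i
    by (simp add: matrix_vector_mult_basis column_def edge_matrix_def vec_eq_iff)
  have lin: "linear ?g" by simp
  have comp: "compact ?std" by (intro finite_imp_compact_convex_hull) auto
  have "insert 0 Basis = insert 0 (range (\<lambda>i. axis i (1::real)) :: (real^'n) set)"
    by (auto simp: Basis_vec_def)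
  then have "?g ` (insert 0 Basis) = insert 0 ((\<lambda>x. x - z) ` range f)"
    by (auto simp: image_iff)
  also have "range f = s - {z}" using f by (simp add: bij_betw_def)
  finally have "(+) z ` ?g ` (insert 0 Basis) = s" using z by (auto simp: image_iff)
  moreover have "convex hull ((+) z ` ?g ` (insert 0 Basis)) = (+) z ` ?g ` ?std"
    by (simp only: convex_hull_linear_image[OF lin] convex_hull_translation)
  ultimately have "convex hull s = (+) z ` ?g ` ?std" by simp
  then have "measure lebesgue (convex hull s) = measure lebesgue (?g ` ?std)"
    by (simp only: measure_translation)
  also have "\<dots> = \<bar>det (edge_matrix f z)\<bar> * measure lebesgue ?std"
    using measure_linear_image_det[OF lin lmeasurable_compact[OF comp]] by simp
  also have "measure lebesgue ?std = measure lborel ?std"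
    using comp by (intro measure_completion) (auto dest: compact_imp_closed)
  finally show ?thesis by (simp add: content_std_simplex)
qed

lemma full_simplex_enumerate:
  fixes s :: "(real^'n) set"
  assumes "full_simplex s" "z \<in> s"
  obtains f :: "'n \<Rightarrow> real^'n" where "bij_betw f UNIV (s - {z})"
proof -
  have "card (UNIV :: 'n set) = card (s - {z})"
    using assms full_simplex_finite[OF assms(1)] by (simp add: full_simplex_def)
  then have "\<exists>f :: 'n \<Rightarrow> real^'n. bij_betw f UNIV (s - {z})"
    using full_simplex_finite[OF assms(1)] by (intro finite_same_card_bij) auto
  then show ?thesis using that by blast
qed

lemma det_Ints:
  fixes A :: "real^'n^'n"
  assumes "\<And>i j. A $ i $ j \<in> \<int>"
  shows "det A \<in> \<int>"
  unfolding det_def by (intro Ints_sum Ints_mult Ints_prod assms) simp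

definition lattice_simplex :: "(real^'n) set \<Rightarrow> bool" where
  "lattice_simplex s \<longleftrightarrow> full_simplex s \<and> s \<subseteq> integer_lattice"

text \<open>
  Volume in units of the standard simplex. For lattice simplices it is an integer, the absolute
  value of the determinant of the edge vectors.
\<close>

definition nvol :: "(real^'n) set \<Rightarrow> real" where
  "nvol K = fact CARD('n) * measure lebesgue K"

lemma edge_matrix_Ints:
  assumes "lattice_simplex s" "z \<in> s" "bij_betw f UNIV (s - {z})"
  shows "edge_matrix f z $ i $ j \<in> \<int>"
proof -
  have "f j \<in> s" using assms(3) by (auto simp: bij_betw_def)
  then have "f j $ i \<in> \<int>" "z $ i \<in> \<int>"
    using assms by (auto simp: lattice_simplex_def integer_lattice_def)
  then show ?thesis by (simp add: edge_matrix_def)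
qed

lemma lmeasurable_convex_hull_simplex: "full_simplex s \<Longrightarrow> convex hull s \<in> lmeasurable"
  by (simp add: full_simplex_finite finite_imp_compact_convex_hull lmeasurable_compact)

lemma nvol_lattice_simplex:
  fixes s :: "(real^'n) set"
  assumes s: "lattice_simplex s"
  shows "1 \<le> nvol (convex hull s)"
proof -
  have full: "full_simplex s" using s by (simp add: lattice_simplex_def)
  then obtain z where z: "z \<in> s" by (fastforce simp: full_simplex_def)
  obtain f :: "'n \<Rightarrow> real^'n" where f: "bij_betw f UNIV (s - {z})" using full_simplex_enumerate[OF full z] .
  have "\<not> negligible (convex hull s)"
    using interior_full_simplex_nonempty[OF full] negligible_convex_interior[of "convex hull s"] by simp
  then have "measure lebesgue (convex hull s) \<noteq> 0"
    using negligible_iff_measure lmeasurable_convex_hull_simplex[OF full] by blast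
  then have nz: "\<bar>det (edge_matrix f z)\<bar> \<noteq> 0" using measure_simplex[OF full z f] by auto
  have "det (edge_matrix f z) \<in> \<int>" by (rule det_Ints[OF edge_matrix_Ints[OF s z f]])
  then obtain k :: int where k: "det (edge_matrix f z) = of_int k" by (auto elim: Ints_cases)
  have "nvol (convex hull s) = of_int \<bar>k\<bar>"
    unfolding nvol_def measure_simplex[OF full z f] using k by simp
  then show ?thesis using nz k by simp
qed

text \<open>
  In a unimodular simplex the lattice points of the \<open>k\<close>-th dilate have integral coordinates: by
  Cramer's rule the coordinates solve an integral linear system with determinant \<open>1\<close> or \<open>-1\<close>.
\<close>

lemma unimodular_bary_Ints:
  fixes s :: "(real^'n) set"
  assumes s: "lattice_simplex s" and unimod: "nvol (convex hull s) = 1"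
    and y: "y \<in> integer_lattice" and k: "0 < k" and w: "w \<in> s"
  shows "real k * bary s (y /\<^sub>R real k) w \<in> \<int>"
proof -
  have full: "full_simplex s" using s by (simp add: lattice_simplex_def)
  note fin = full_simplex_finite[OF full]
  have coord: "real k * bary s (y /\<^sub>R real k) v \<in> \<int>" if "z \<in> s" and vz: "v \<in> s - {z}" for z v
  proof -
    obtain f :: "'n \<Rightarrow> real^'n" where f: "bij_betw f UNIV (s - {z})"
      using full_simplex_enumerate[OF full \<open>z \<in> s\<close>] .
    let ?A = "edge_matrix f z" and ?b = "bary s (y /\<^sub>R real k)"
    let ?x = "\<chi> j. real k * ?b (f j)"
    have "\<bar>det ?A\<bar> = 1"
      using unimod measure_simplex[OF full \<open>z \<in> s\<close> f] by (simp add: nvol_def)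
    then have det: "det ?A = 1 \<or> det ?A = -1" by linarith
    have "?A *v ?x = real k *\<^sub>R (\<Sum>j\<in>UNIV. ?b (f j) *\<^sub>R (f j - z))"
      unfolding edge_matrix_mult by (simp add: scaleR_sum_right)
    also have "(\<Sum>j\<in>UNIV. ?b (f j) *\<^sub>R (f j - z)) = (\<Sum>u\<in>s-{z}. ?b u *\<^sub>R (u - z))"
      by (rule sum.reindex_bij_betw[OF f])
    also have "\<dots> = (\<Sum>u\<in>s. ?b u *\<^sub>R (u - z))"
      using sum.remove[OF fin \<open>z \<in> s\<close>, of "\<lambda>u. ?b u *\<^sub>R (u - z)"] by simp
    also have "\<dots> = (\<Sum>u\<in>s. ?b u *\<^sub>R u) - (\<Sum>u\<in>s. ?b u) *\<^sub>R z"
      by (simp add: scaleR_diff_right sum_subtractf scaleR_sum_left)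
    also have "\<dots> = y /\<^sub>R real k - z" by (simp add: sum_bary[OF full] bary_combination[OF full])
    finally have Ax: "?A *v ?x = y - real k *\<^sub>R z"
      using k by (simp add: scaleR_diff_right)
    obtain j where j: "v = f j" using f vz by (auto simp: bij_betw_def)
    have "z $ i \<in> \<int>" "y $ i \<in> \<int>" for i
      using s y \<open>z \<in> s\<close> by (auto simp: lattice_simplex_def integer_lattice_def)
    then have "(?A *v ?x) $ i \<in> \<int>" for i unfolding Ax by simp
    then have "det (\<chi> i j'. if j' = j then (?A *v ?x) $ i else ?A $ i $ j') \<in> \<int>"
      using edge_matrix_Ints[OF s \<open>z \<in> s\<close> f] by (intro det_Ints) simp
    then have "?x $ j * det ?A \<in> \<int>" unfolding cramer_lemma .
    then show ?thesis using det j by auto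
  qed
  have "1 < card s" using full by (simp add: full_simplex_def)
  then obtain z where "z \<in> s" "z \<noteq> w"
    using fin w by (metis card_le_Suc0_iff_eq One_nat_def not_le)
  then show ?thesis using coord w by blast
qed

lemma measure_dissection:
  assumes T: "dissection T K"
  shows "measure lebesgue K = (\<Sum>s\<in>T. measure lebesgue (convex hull s))"
proof -
  have "negligible (convex hull s \<inter> convex hull t)" if "s \<in> T" "t \<in> T" "s \<noteq> t" for s t
  proof (rule negligible_subset)
    show "negligible (frontier (convex hull s) \<union> frontier (convex hull t))"
      by (simp add: negligible_convex_frontier)
    have "interior (convex hull s) \<inter> interior (convex hull t) = {}"
      using T that by (simp add: dissection_def)
    then show "convex hull s \<inter> convex hull t \<subseteq> frontier (convex hull s) \<union> frontier (convex hull t)"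
      unfolding frontier_def using closure_subset[of "convex hull s"] closure_subset[of "convex hull t"] by blast
  qed
  then have "measure lebesgue (\<Union> ((\<lambda>s. convex hull s) ` T)) = (\<Sum>s\<in>T. measure lebesgue (convex hull s))"
    using dissectionD(1,2)[OF T] lmeasurable_convex_hull_simplex
    by (intro measure_negligible_finite_Union_image) (auto simp: pairwise_def)
  then show ?thesis using dissectionD(3)[OF T] by simp
qed

lemma nvol_dissection:
  assumes "dissection T K" shows "nvol K = (\<Sum>s\<in>T. nvol (convex hull s))"
  using measure_dissection[OF assms] by (simp add: nvol_def sum_distrib_left)

section \<open>Triangulating a polytope on its vertices\<close>

text \<open>
  The affine function that takes the values \<open>\<omega>\<close> at the vertices of \<open>s\<close>.
\<close>

definition interpolant :: "'a::euclidean_space set \<Rightarrow> ('a \<Rightarrow> real) \<Rightarrow> 'a \<Rightarrow> real" where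
  "interpolant s \<omega> x = (\<Sum>v\<in>s. bary s x v * \<omega> v)"

lemma interpolant_affine:
  assumes s: "full_simplex s" and I: "finite I" "sum c I = 1"
  shows "interpolant s \<omega> (\<Sum>i\<in>I. c i *\<^sub>R y i) = (\<Sum>i\<in>I. c i * interpolant s \<omega> (y i))"
proof -
  have "interpolant s \<omega> (\<Sum>i\<in>I. c i *\<^sub>R y i) = (\<Sum>v\<in>s. \<Sum>i\<in>I. c i * bary s (y i) v * \<omega> v)"
    unfolding interpolant_def by (simp add: bary_affine[OF s I] sum_distrib_right)
  also have "\<dots> = (\<Sum>i\<in>I. c i * interpolant s \<omega> (y i))"
    unfolding interpolant_def by (subst sum.swap) (simp add: sum_distrib_left mult.assoc)
  finally show ?thesis .
qed

text \<open>
  An affine function is determined by its values at the vertices of any full-dimensional simplex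
  \<open>s\<close>, not just of its own simplex \<open>t\<close>.
\<close>

lemma interpolant_bary:
  assumes s: "full_simplex s" and t: "full_simplex t"
  shows "interpolant t \<omega> x = (\<Sum>v\<in>s. bary s x v * interpolant t \<omega> v)"
  using interpolant_affine[OF t full_simplex_finite[OF s] sum_bary[OF s], of \<omega> x "\<lambda>v. v"]
  by (simp add: bary_combination[OF s])

lemma interpolant_vertex:
  assumes s: "full_simplex s" and "v \<in> s"
  shows "interpolant s \<omega> v = \<omega> v"
proof -
  have "interpolant s \<omega> v = (\<Sum>u\<in>s. if u = v then \<omega> v else 0)"
    unfolding interpolant_def by (rule sum.cong) (use bary_vertex[OF s _ \<open>v \<in> s\<close>] in auto)
  then show ?thesis using assms full_simplex_finite[OF s] by simp
qed

text \<open>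
  Take powers of a number \<open>t\<close> with distinct exponents as heights. Each unwanted coincidence says
  that \<open>t\<close> is a root of a polynomial in which the height of \<open>u\<close> has coefficient \<open>1\<close>, so only
  finitely many \<open>t\<close> are excluded.
\<close>

lemma generic_heights:
  fixes V :: "'a::euclidean_space set"
  assumes "finite V"
  obtains \<omega> where "\<And>s u. s \<subseteq> V \<Longrightarrow> full_simplex s \<Longrightarrow> u \<in> V - s \<Longrightarrow> interpolant s \<omega> u \<noteq> \<omega> u"
proof -
  obtain idx :: "'a \<Rightarrow> nat" where idx: "inj_on idx V"
    using finite_imp_inj_to_nat_seg[OF assms] by blast
  \<comment> \<open>At \<open>t\<close> this polynomial takes the value \<open>\<omega> u - interpolant s \<omega> u\<close> for the heights \<open>\<omega> v = t ^ idx v\<close>.\<close>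
  define p where "p = (\<lambda>(s, u). monom 1 (idx u) - (\<Sum>v\<in>s. monom (bary s u v) (idx v)) :: real poly)"
  define C where "C = (SIGMA s:{s. s \<subseteq> V \<and> full_simplex s}. V - s)"
  have "finite C" unfolding C_def using assms by (intro finite_SigmaI) auto
  moreover have "finite {t. poly (p c) t = 0}" if cC: "c \<in> C" for c
  proof -
    obtain s u where c: "c = (s, u)" and s: "s \<subseteq> V" "u \<in> V - s"
      using cC by (auto simp: C_def)
    have "coeff (p c) (idx u) = 1 - (\<Sum>v\<in>s. if idx v = idx u then bary s u v else 0)"
      by (simp add: p_def c coeff_sum)
    also have "(\<Sum>v\<in>s. if idx v = idx u then bary s u v else 0) = 0"
      using s idx by (intro sum.neutral) (auto simp: inj_on_def)
    finally have "p c \<noteq> 0" by auto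
    then show ?thesis by (rule poly_roots_finite)
  qed
  ultimately have "finite (\<Union>c\<in>C. {t. poly (p c) t = 0})" by blast
  then obtain t where t: "t \<notin> (\<Union>c\<in>C. {t. poly (p c) t = 0})"
    using ex_new_if_finite infinite_UNIV_char_0 by blast
  show ?thesis
  proof (rule that[of "\<lambda>v. t ^ idx v"])
    fix s u assume "s \<subseteq> V" "full_simplex s" "u \<in> V - s"
    then have "poly (p (s, u)) t \<noteq> 0" using t by (auto simp: C_def)
    then show "interpolant s (\<lambda>v. t ^ idx v) u \<noteq> t ^ idx u"
      by (simp add: p_def interpolant_def poly_monom poly_sum)
  qed
qed

lemma low_dimensional_affine_hull_negligible:
  fixes A :: "'a::euclidean_space set"
  assumes "affine hull A \<noteq> UNIV"
  shows "negligible (affine hull A)"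
proof -
  have "aff_dim (affine hull A) \<noteq> DIM('a)" using assms aff_dim_eq_full[of A] by simp
  then have "interior (affine hull A) = {}" using aff_dim_nonempty_interior by blast
  then show ?thesis using negligible_convex_interior[of "affine hull A"] affine_imp_convex affine_affine_hull by blast
qed

text \<open>
  Caratheodory's theorem provides at most \<open>n + 1\<close> points; fewer points, or affinely dependent ones,
  would span a proper affine subspace, which \<open>x\<close> avoids.
\<close>

lemma affinely_spanning_simplex:
  fixes V :: "'a::euclidean_space set"
  assumes x: "x \<in> convex hull V" and gen: "\<And>A. A \<subseteq> V \<Longrightarrow> affine hull A \<noteq> UNIV \<Longrightarrow> x \<notin> affine hull A"
  shows "\<exists>s\<subseteq>V. full_simplex s \<and> x \<in> convex hull s"
proof -
  obtain s where s: "finite s" "s \<subseteq> V" "card s \<le> aff_dim V + 1" "x \<in> convex hull s"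
    using x caratheodory_aff_dim[of V] by auto
  then have span: "affine hull s = UNIV"
    using gen[of s] convex_hull_subset_affine_hull[of s] by blast
  then have "int DIM('a) = aff_dim s" using aff_dim_eq_full by metis
  moreover have "aff_dim s \<le> int (card s) - 1" using aff_dim_le_card[OF s(1)] by simp
  moreover have "int (card s) \<le> int DIM('a) + 1" using s(3) aff_dim_le_DIM[of V] by linarith
  ultimately have "card s = Suc DIM('a)" by linarith
  then show ?thesis using s span unfolding full_simplex_def by blast
qed

text \<open>
  Among the simplices that contain \<open>x\<close> choose one whose interpolant is lowest at \<open>x\<close>. If a further
  point \<open>u\<close> were below the interpolant, pivoting \<open>u\<close> in would keep \<open>x\<close> in the simplex and lower the
  value at \<open>x\<close>, strictly because \<open>x\<close> has only positive coordinates. This is optimality of a basis in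
  linear programming.
\<close>

lemma lower_hull_simplex:
  fixes V :: "'a::euclidean_space set"
  assumes V: "finite V" and x: "x \<in> convex hull V"
    and gen: "\<And>A. A \<subseteq> V \<Longrightarrow> affine hull A \<noteq> UNIV \<Longrightarrow> x \<notin> affine hull A"
    and \<omega>: "\<And>s u. s \<subseteq> V \<Longrightarrow> full_simplex s \<Longrightarrow> u \<in> V - s \<Longrightarrow> interpolant s \<omega> u \<noteq> \<omega> u"
  shows "\<exists>s\<subseteq>V. full_simplex s \<and> x \<in> convex hull s \<and> (\<forall>u\<in>V - s. interpolant s \<omega> u < \<omega> u)"
proof -
  let ?C = "{s. s \<subseteq> V \<and> full_simplex s \<and> x \<in> convex hull s}"
  have "finite ?C" "?C \<noteq> {}"
    using V affinely_spanning_simplex[OF x gen] by auto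
  then obtain s where "is_arg_min (\<lambda>s. interpolant s \<omega> x) (\<lambda>s. s \<in> ?C) s"
    using ex_is_arg_min_if_finite[of ?C "\<lambda>s. interpolant s \<omega> x"] by blast
  then have sV: "s \<subseteq> V" and full: "full_simplex s" and xs: "x \<in> convex hull s"
    and min: "\<And>t. t \<subseteq> V \<Longrightarrow> full_simplex t \<Longrightarrow> x \<in> convex hull t \<Longrightarrow> interpolant s \<omega> x \<le> interpolant t \<omega> x"
    unfolding is_arg_min_linorder by auto
  note fin = full_simplex_finite[OF full]
  have "interpolant s \<omega> u < \<omega> u" if u: "u \<in> V - s" for u
  proof (rule ccontr)
    assume "\<not> interpolant s \<omega> u < \<omega> u"
    then have above: "\<omega> u < interpolant s \<omega> u" using \<omega>[OF sV full u] by simp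
    obtain v where v: "v \<in> supp s u" and xt: "x \<in> convex hull (insert u (s - {v}))"
      using star_subdivision_cover[OF full xs] by blast
    have vs: "v \<in> s" and c: "0 < bary s u v" using v by (auto simp: supp_def)
    let ?t = "insert u (s - {v})"
    have cn: "bary s u v \<noteq> 0" using c by simp
    have ft: "full_simplex ?t" by (rule exchange_vertex_full[OF full vs cn])
    have "x \<notin> affine hull (s - {v})"
    proof (rule gen)
      show "s - {v} \<subseteq> V" using sV by blast
      have "aff_dim (s - {v}) \<le> int (card (s - {v})) - 1" using aff_dim_le_card fin by blast
      also have "\<dots> < DIM('a)" using full vs fin by (simp add: full_simplex_def)
      finally show "affine hull (s - {v}) \<noteq> UNIV" using aff_dim_eq_full[of "s - {v}"] by simp
    qed
    moreover have "x \<in> affine hull (s - {v})" if "bary s x v = 0"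
    proof -
      have "sum (bary s x) (s - {v}) = 1" "(\<Sum>w\<in>s-{v}. bary s x w *\<^sub>R w) = x"
        using sum.remove[OF fin vs, of "bary s x"] sum.remove[OF fin vs, of "\<lambda>w. bary s x w *\<^sub>R w"]
          sum_bary[OF full] bary_combination[OF full] that by auto
      moreover have "finite (s - {v})" using fin by simp
      ultimately show ?thesis by (auto simp: affine_hull_finite)
    qed
    ultimately have "0 < bary s x v"
      using xs vs by (force simp: convex_hull_bary[OF full])
    then have pos: "0 < bary ?t x u" using exchange_vertex_new[OF full vs cn, of x] c by simp
    have nu: "u \<notin> s - {v}" using u by blast
    have "interpolant ?t \<omega> x = bary ?t x u * \<omega> u + (\<Sum>w\<in>s-{v}. bary ?t x w * \<omega> w)"
      unfolding interpolant_def using fin nu by (intro sum.insert) auto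
    also have "\<dots> < bary ?t x u * interpolant s \<omega> u + (\<Sum>w\<in>s-{v}. bary ?t x w * interpolant s \<omega> w)"
      using pos above interpolant_vertex[OF full] by simp
    also have "\<dots> = (\<Sum>w\<in>?t. bary ?t x w * interpolant s \<omega> w)"
      using fin nu by (intro sum.insert[symmetric]) auto
    also have "\<dots> = interpolant s \<omega> x" by (rule interpolant_bary[OF ft full, symmetric])
    finally show False using min[OF _ ft xt] sV u by auto
  qed
  then show ?thesis using sV full xs by blast
qed

text \<open>
  Lift the points to generic heights and take the simplices below whose interpolant no lifted point
  lies, the projection of the lower convex hull. Two of them with a common interior point \<open>x\<close> would
  each have the strictly lower interpolant at \<open>x\<close>. They cover a dense set by \<open>lower_hull_simplex\<close>,
  and their union is closed.
\<close>

lemma regular_triangulation: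
  fixes V :: "'a::euclidean_space set"
  assumes V: "finite V" and span: "affine hull V = UNIV"
  shows "\<exists>T. dissection T (convex hull V) \<and> \<Union>T \<subseteq> V"
proof -
  obtain \<omega> where \<omega>: "\<And>s u. s \<subseteq> V \<Longrightarrow> full_simplex s \<Longrightarrow> u \<in> V - s \<Longrightarrow> interpolant s \<omega> u \<noteq> \<omega> u"
    using generic_heights[OF V] by blast
  define T where "T = {s. s \<subseteq> V \<and> full_simplex s \<and> (\<forall>u\<in>V-s. interpolant s \<omega> u < \<omega> u)}"
  \<comment> \<open>The proper affine subspaces spanned by vertices, on which pivoting may degenerate.\<close>
  define Bad where "Bad = (\<Union>A\<in>{A. A \<subseteq> V \<and> affine hull A \<noteq> UNIV}. affine hull A)"
  have finT: "finite T" unfolding T_def using V by auto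
  have closed: "closed (\<Union>s\<in>T. convex hull s)"
    using finT full_simplex_finite
    by (intro closed_UN ballI) (auto simp: T_def intro!: compact_imp_closed finite_imp_compact_convex_hull)
  have "negligible Bad"
    unfolding Bad_def using V low_dimensional_affine_hull_negligible
    by (intro negligible_Union) auto
  have cover: "(\<Union>s\<in>T. convex hull s) = convex hull V"
  proof
    show "(\<Union>s\<in>T. convex hull s) \<subseteq> convex hull V"
      by (rule UN_least, rule hull_mono) (simp add: T_def)
    show "convex hull V \<subseteq> (\<Union>s\<in>T. convex hull s)"
    proof (rule ccontr)
      assume "\<not> ?thesis"
      then obtain x where x: "x \<in> convex hull V" "x \<in> - (\<Union>s\<in>T. convex hull s)" by blast
      let ?U = "interior (convex hull V) \<inter> - (\<Union>s\<in>T. convex hull s)"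
      have "rel_interior (convex hull V) = interior (convex hull V)"
        using span by (intro rel_interior_interior) simp
      then have "x \<in> closure (interior (convex hull V))"
        using convex_closure_rel_interior[of "convex hull V"] closure_subset x(1) by auto
      then have "?U \<noteq> {}"
        using open_Int_closure_eq_empty[of "- (\<Union>s\<in>T. convex hull s)" "interior (convex hull V)"]
          closed x(2) by (auto simp: open_closed)
      moreover have "open ?U" using open_Int[OF open_interior] closed[unfolded closed_def] by blast
      ultimately have "\<not> negligible ?U" by (simp add: open_not_negligible)
      then have "\<not> ?U \<subseteq> Bad" using \<open>negligible Bad\<close> negligible_subset by blast
      then obtain y where y: "y \<in> ?U" "y \<notin> Bad" by blast
      then have "y \<in> convex hull V" using interior_subset by blast
      then have "\<exists>s\<in>T. y \<in> convex hull s"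
        using lower_hull_simplex[OF V _ _ \<omega>, of y] y(2) unfolding T_def Bad_def by blast
      then show False using y(1) by blast
    qed
  qed
  have below: "interpolant t \<omega> x < interpolant s \<omega> x"
    if s: "s \<in> T" and t: "t \<in> T" and ne: "s \<noteq> t" and x: "x \<in> interior (convex hull s)" for s t x
  proof -
    have fs: "full_simplex s" "full_simplex t" using s t by (auto simp: T_def)
    note fin = full_simplex_finite[OF fs(1)] full_simplex_finite[OF fs(2)]
    have "\<not> s \<subseteq> t"
      using card_subset_eq[OF fin(2), of s] fs ne by (auto simp: full_simplex_def)
    then obtain w where w: "w \<in> s" "w \<notin> t" by blast
    have pos: "0 < bary s x v" if "v \<in> s" for v
      using x that by (simp add: interior_convex_hull_bary[OF fs(1)])
    have le: "interpolant t \<omega> v \<le> \<omega> v" if "v \<in> s" for v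
      using that s t interpolant_vertex[OF fs(2), of v] by (cases "v \<in> t") (auto simp: T_def less_imp_le)
    have less: "interpolant t \<omega> w < \<omega> w" using w s t by (auto simp: T_def)
    have "interpolant t \<omega> x = (\<Sum>v\<in>s. bary s x v * interpolant t \<omega> v)"
      by (rule interpolant_bary[OF fs])
    also have "\<dots> < (\<Sum>v\<in>s. bary s x v * \<omega> v)"
    proof (rule sum_strict_mono_ex1[OF fin(1)])
      show "\<forall>v\<in>s. bary s x v * interpolant t \<omega> v \<le> bary s x v * \<omega> v"
        using pos le by (simp add: mult_left_mono less_imp_le)
      show "\<exists>v\<in>s. bary s x v * interpolant t \<omega> v < bary s x v * \<omega> v"
        using w(1) less pos by (intro bexI[of _ w]) simp_all
    qed
    finally show ?thesis by (simp add: interpolant_def)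
  qed
  have "dissection T (convex hull V)"
    unfolding dissection_def
  proof (intro conjI ballI impI)
    fix s t assume st: "s \<in> T" "t \<in> T" "s \<noteq> t"
    show "interior (convex hull s) \<inter> interior (convex hull t) = {}"
    proof (rule ccontr)
      assume "interior (convex hull s) \<inter> interior (convex hull t) \<noteq> {}"
      then obtain x where "x \<in> interior (convex hull s)" "x \<in> interior (convex hull t)" by blast
      then show False using below[OF st(1,2,3)] below[OF st(2,1)] st(3) by (metis less_asym)
    qed
  qed (use finT cover in \<open>auto simp: T_def\<close>)
  then show ?thesis unfolding T_def by blast
qed

section \<open>The volume bound and its equality case\<close>

lemma finite_lattice_points:
  fixes S :: "(real^'n) set"
  assumes "bounded S"
  shows "finite (S \<inter> integer_lattice)"
proof -
  obtain B where B: "\<And>x. x \<in> S \<Longrightarrow> norm x \<le> B" using assms by (auto simp: bounded_iff)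
  let ?R = "real_of_int ` {- \<lceil>B\<rceil>..\<lceil>B\<rceil>}"
  have "S \<inter> integer_lattice \<subseteq> vec_lambda ` (UNIV \<rightarrow>\<^sub>E ?R)"
  proof
    fix x assume x: "x \<in> S \<inter> integer_lattice"
    have "x $ i \<in> ?R" for i
    proof -
      have "x $ i \<in> \<int>" using x by (simp add: integer_lattice_def)
      then obtain z where z: "x $ i = of_int z" by (auto elim: Ints_cases)
      have "\<bar>x $ i\<bar> \<le> B" using component_le_norm_cart[of x i] B x by force
      then have "real_of_int \<bar>z\<bar> \<le> real_of_int \<lceil>B\<rceil>" using z by linarith
      then have "\<bar>z\<bar> \<le> \<lceil>B\<rceil>" by linarith
      then show ?thesis using z by (intro image_eqI[of _ _ z]) auto
    qed
    then have "vec_nth x \<in> UNIV \<rightarrow>\<^sub>E ?R" by auto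
    then show "x \<in> vec_lambda ` (UNIV \<rightarrow>\<^sub>E ?R)"
      by (metis image_eqI vec_nth_inverse)
  qed
  moreover have "finite (vec_lambda ` ((UNIV :: 'n set) \<rightarrow>\<^sub>E ?R))"
    by (intro finite_imageI finite_PiE) auto
  ultimately show ?thesis using finite_subset by blast
qed

definition interior_lattice_points :: "(real^'n) set \<Rightarrow> (real^'n) set" where
  "interior_lattice_points K = interior K \<inter> integer_lattice"

lemma finite_interior_lattice_points:
  "full_simplex s \<Longrightarrow> finite (interior_lattice_points (convex hull s))"
  unfolding interior_lattice_points_def
  using full_simplex_finite finite_imp_bounded_convex_hull bounded_subset[OF _ interior_subset]
  by (intro finite_lattice_points) blast

lemma vertex_notin_interior:
  assumes s: "full_simplex s" and "v \<in> s"
  shows "v \<notin> interior (convex hull s)"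
proof
  assume v: "v \<in> interior (convex hull s)"
  have "1 < card s" using s by (simp add: full_simplex_def)
  then obtain w where w: "w \<in> s" "w \<noteq> v"
    using full_simplex_finite[OF s] \<open>v \<in> s\<close> by (metis card_le_Suc0_iff_eq One_nat_def not_le)
  then show False
    using v bary_vertex[OF s w(1) \<open>v \<in> s\<close>] by (force simp: interior_convex_hull_bary[OF s])
qed

definition lattice_dissection :: "(real^'n) set set \<Rightarrow> (real^'n) set \<Rightarrow> bool" where
  "lattice_dissection T K \<longleftrightarrow> dissection T K \<and> \<Union>T \<subseteq> integer_lattice"

lemma lattice_dissectionD:
  assumes "lattice_dissection T K"
  shows "dissection T K" "\<And>s. s \<in> T \<Longrightarrow> lattice_simplex s" "finite T"
  using assms dissectionD by (auto simp: lattice_dissection_def lattice_simplex_def)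

lemma lattice_dissection_singleton: "lattice_simplex s \<Longrightarrow> lattice_dissection {s} (convex hull s)"
  by (simp add: lattice_dissection_def lattice_simplex_def dissection_singleton)

text \<open>
  Every lattice simplex contributes at least \<open>1\<close> to the volume.
\<close>

lemma card_le_nvol:
  assumes "lattice_dissection T K"
  shows "real (card T) \<le> nvol K"
    and "real (card T) = nvol K \<Longrightarrow> s \<in> T \<Longrightarrow> nvol (convex hull s) = 1"
proof -
  note T = lattice_dissectionD[OF assms]
  have ge: "0 \<le> nvol (convex hull s) - 1" if "s \<in> T" for s
    using nvol_lattice_simplex[OF T(2)[OF that]] by simp
  have eq: "nvol K - card T = (\<Sum>s\<in>T. nvol (convex hull s) - 1)"
    using nvol_dissection[OF T(1)] by (simp add: sum_subtractf)
  have "0 \<le> (\<Sum>s\<in>T. nvol (convex hull s) - 1)" by (rule sum_nonneg) (rule ge)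
  then show "real (card T) \<le> nvol K" using eq by simp
  show "nvol (convex hull s) = 1" if "real (card T) = nvol K" "s \<in> T"
    using sum_nonneg_0[OF T(3) ge] eq that by force
qed

lemma lattice_dissection_insert_point:
  assumes "lattice_dissection T K" "p \<in> integer_lattice"
  shows "lattice_dissection (insert_point T p) K"
  using assms dissection_insert_point Union_insert_point[of T p]
  unfolding lattice_dissection_def by blast

text \<open>
  By \<open>star_increment_ge\<close> each point adds at least \<open>n\<close> simplices. The points of \<open>N\<close> still to be
  inserted do not become vertices on the way.
\<close>

lemma insert_interior_lattice_points:
  fixes T :: "(real^'n) set set"
  assumes "finite N" "lattice_dissection T K" "N \<subseteq> interior_lattice_points K" "N \<inter> \<Union>T = {}"
  shows "\<exists>T'. lattice_dissection T' K \<and> card T + CARD('n) * card N \<le> card T'"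
  using assms
proof (induction N arbitrary: T rule: finite_induct)
  case empty
  then show ?case by auto
next
  case (insert p N)
  have p: "p \<in> interior K" "p \<in> integer_lattice" "p \<notin> \<Union>T"
    using insert.prems by (auto simp: interior_lattice_points_def)
  note T = lattice_dissectionD(1)[OF insert.prems(1)]
  let ?T = "insert_point T p"
  have "N \<inter> \<Union>?T = {}"
    using Union_insert_point[of T p] insert.prems(3) insert.hyps(2) by blast
  then obtain T' where T': "lattice_dissection T' K" "card ?T + CARD('n) * card N \<le> card T'"
    using insert.IH[OF lattice_dissection_insert_point[OF insert.prems(1) p(2)]] insert.prems(2) by blast
  have "card T + CARD('n) \<le> card ?T"
    using card_insert_point[OF T, of p] star_increment_ge[OF T p(1,3)] by simp
  then show ?case using T' insert.hyps by (intro exI[of _ T']) auto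
qed

lemma nvol_lower_bound:
  fixes T :: "(real^'n) set set"
  assumes "finite N" "lattice_dissection T K" "N \<subseteq> interior_lattice_points K" "N \<inter> \<Union>T = {}"
  shows "real (card T + CARD('n) * card N) \<le> nvol K"
proof -
  obtain T' where "lattice_dissection T' K" "card T + CARD('n) * card N \<le> card T'"
    using insert_interior_lattice_points[OF assms] by blast
  then show ?thesis using card_le_nvol(1)[of T' K] by linarith
qed

text \<open>
  Equality in \<open>nvol_lower_bound\<close> for the dissection that consists of \<open>s\<close> alone.
\<close>

definition tight :: "(real^'n) set \<Rightarrow> bool" where
  "tight s \<longleftrightarrow> lattice_simplex s \<and>
     nvol (convex hull s) = real (CARD('n) * card (interior_lattice_points (convex hull s)) + 1)"

lemma tight_imp_full: "tight s \<Longrightarrow> full_simplex s"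
  by (simp add: tight_def lattice_simplex_def)

lemma insert_point_singleton:
  "p \<in> convex hull s \<Longrightarrow> insert_point {s} p = star_subdivision s p"
  by (simp add: insert_point_def)

text \<open>
  Inserting a boundary lattice point first would produce a second simplex, and the remaining
  insertions of interior points would exceed the volume.
\<close>

lemma tight_lattice_point:
  fixes s :: "(real^'n) set"
  assumes s: "tight s" and x: "x \<in> convex hull s" "x \<in> integer_lattice" "x \<notin> s"
  shows "x \<in> interior_lattice_points (convex hull s)"
proof (rule ccontr)
  assume not: "x \<notin> interior_lattice_points (convex hull s)"
  let ?N = "interior_lattice_points (convex hull s)"
  note full = tight_imp_full[OF s]
  have T: "lattice_dissection {s} (convex hull s)"
    using s by (intro lattice_dissection_singleton) (simp add: tight_def)
  have "?N \<inter> \<Union>(insert_point {s} x) = {}"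
    using Union_insert_point[of "{s}" x] not vertex_notin_interior[OF full]
    by (auto simp: interior_lattice_points_def)
  then have "real (card (insert_point {s} x) + CARD('n) * card ?N) \<le> nvol (convex hull s)"
    using nvol_lower_bound[OF finite_interior_lattice_points[OF full]
        lattice_dissection_insert_point[OF T x(2)]] by blast
  moreover have "2 \<le> card (insert_point {s} x)"
    using card_star_subdivision[OF full] card_supp_ge_2[OF full x(1,3)] insert_point_singleton[OF x(1)] by simp
  ultimately show False using s by (simp add: tight_def)
qed

lemma supp_interior:
  assumes s: "full_simplex s" shows "supp s p = s \<longleftrightarrow> p \<in> interior (convex hull s)"
  unfolding interior_convex_hull_bary[OF s] by (auto simp: supp_def)

text \<open>
  Insert \<open>p\<close>, then \<open>x\<close>, then the other interior lattice points. As the volume is just exhausted, the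
  increment at \<open>x\<close> is exactly \<open>n\<close>, and \<open>star_increment_eq\<close> applies.
\<close>

lemma tight_second_point:
  fixes s :: "(real^'n) set"
  assumes s: "tight s" and p: "p \<in> interior_lattice_points (convex hull s)"
    and x: "x \<in> interior_lattice_points (convex hull s)" "x \<noteq> p"
    and t: "t \<in> star_subdivision s p" "x \<in> convex hull t"
  shows "card (supp t x) - 1 \<in> {1, CARD('n)}"
proof -
  let ?I = "interior_lattice_points (convex hull s)"
  let ?T = "star_subdivision s p"
  note full = tight_imp_full[OF s]
  have pint: "p \<in> interior (convex hull s)" "p \<in> integer_lattice" and pin: "p \<in> convex hull s"
    using p interior_subset by (auto simp: interior_lattice_points_def)
  have xint: "x \<in> interior (convex hull s)" "x \<in> integer_lattice"
    using x by (auto simp: interior_lattice_points_def)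
  have T: "lattice_dissection ?T (convex hull s)"
    using s pint(2) lattice_dissection_insert_point[of "{s}" "convex hull s" p]
    by (simp add: lattice_dissection_singleton tight_def insert_point_singleton[OF pin])
  have UT: "\<Union>?T \<subseteq> insert p s"
    using Union_insert_point[of "{s}" p] insert_point_singleton[OF pin] by simp
  have cardT: "card ?T = CARD('n) + 1"
    using card_star_subdivision[OF full, of p] supp_interior[OF full, of p] pint full
    by (simp add: full_simplex_def)
  have xT: "x \<notin> \<Union>?T" using UT x(2) vertex_notin_interior[OF full] xint by blast
  let ?A = "{t \<in> ?T. x \<in> convex hull t}"
  let ?\<Sigma> = "\<Sum>t\<in>?A. card (supp t x) - 1"
  note D = lattice_dissectionD(1)[OF T]
  have ge: "CARD('n) \<le> ?\<Sigma>" using star_increment_ge[OF D xint(1) xT] by simp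
  \<comment> \<open>Inserting the remaining points costs at least \<open>n\<close> each and bounds the increment at \<open>x\<close> from above.\<close>
  let ?N = "?I - {p, x}"
  have finI: "finite ?I" by (rule finite_interior_lattice_points[OF full])
  have "?N \<inter> \<Union>(insert_point ?T x) = {}"
    using Union_insert_point[of ?T x] UT vertex_notin_interior[OF full]
    by (auto simp: interior_lattice_points_def)
  then have "real (card (insert_point ?T x) + CARD('n) * card ?N) \<le> nvol (convex hull s)"
    using nvol_lower_bound[OF _ lattice_dissection_insert_point[OF T xint(2)], of ?N] finI by blast
  then have "card (insert_point ?T x) + CARD('n) * card ?N \<le> CARD('n) * card ?I + 1"
    using s unfolding tight_def of_nat_le_iff[symmetric, where 'a=real] by linarith
  moreover have "card ?N + 2 = card ?I"
  proof -
    have "card {p, x} = 2" "{p, x} \<subseteq> ?I" using x p by auto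
    then show ?thesis using card_Diff_subset[of "{p,x}" ?I] card_mono[OF finI, of "{p,x}"] by simp
  qed
  then have "CARD('n) * card ?I = CARD('n) * card ?N + 2 * CARD('n)"
    by (metis add_mult_distrib2 mult.commute)
  moreover have "card (insert_point ?T x) = CARD('n) + 1 + ?\<Sigma>"
    using card_insert_point[OF D, of x] cardT by simp
  ultimately have "?\<Sigma> = CARD('n)" using ge by linarith
  then have "\<forall>t\<in>?A. card (supp t x) - 1 \<in> {1, CARD('n)}"
    using star_increment_eq[OF D xint(1) xT] by simp
  then show ?thesis using t by blast
qed

text \<open>
  Suppose that every interior lattice point \<open>p\<close> had a successor on an open segment from \<open>p\<close> to a
  vertex. Two consecutive steps must aim at the same vertex: moving from \<open>p\<close> towards \<open>v\<close> and then
  towards another vertex \<open>w\<close> leads to a point in the relative interior of a triangle \<open>p, v, w\<close>,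
  which is a face of a simplex in the star subdivision at \<open>p\<close>, while \<open>tight_second_point\<close> only
  permits faces of dimension \<open>1\<close> or \<open>n\<close>, and \<open>n \<ge> 3\<close>. So consecutive steps aim at one and the same
  vertex \<open>v\<close>; but each step increases the coordinate at \<open>v\<close>, and there are finitely many points. In
  dimension \<open>2\<close> such steps can go round in a cycle.
\<close>

lemma exists_extremal_point:
  fixes s :: "(real^'n) set"
  assumes s: "tight s" and ne: "interior_lattice_points (convex hull s) \<noteq> {}" and n3: "3 \<le> CARD('n)"
  shows "\<exists>p\<in>interior_lattice_points (convex hull s). \<forall>x\<in>interior_lattice_points (convex hull s).
           \<forall>v\<in>s. \<forall>r>0. r < 1 \<longrightarrow> x \<noteq> p + r *\<^sub>R (v - p)"
proof (rule ccontr)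
  let ?I = "interior_lattice_points (convex hull s)"
  assume "\<not> ?thesis"
  then have succ: "\<exists>x\<in>?I. \<exists>v\<in>s. \<exists>r. 0 < r \<and> r < 1 \<and> x = p + r *\<^sub>R (v - p)" if "p \<in> ?I" for p
    using that by blast
  note full = tight_imp_full[OF s]
  have int: "0 < bary s p v" if "p \<in> ?I" "v \<in> s" for p v
    using that by (simp add: interior_lattice_points_def interior_convex_hull_bary[OF full])
  have same: "v = w"
    if pI: "p \<in> ?I" and xI: "x \<in> ?I" and yI: "y \<in> ?I" and vs: "v \<in> s" and ws: "w \<in> s"
      and a: "0 < a" "a < 1" and xeq: "x = p + a *\<^sub>R (v - p)"
      and b: "0 < b" "b < 1" and yeq: "y = x + b *\<^sub>R (w - x)" for p x y v w a b
  proof (rule ccontr)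
    assume vw: "v \<noteq> w"
    have "card {v, w} < card s" using n3 full vw by (simp add: full_simplex_def)
    then have "s - {v, w} \<noteq> {}"
      by (metis Diff_eq_empty_iff card_mono finite.emptyI finite.insertI not_less)
    then obtain z where z: "z \<in> s" "z \<noteq> v" "z \<noteq> w" by blast
    let ?t = "insert p (s - {z})"
    have c: "bary s p z \<noteq> 0" using int[OF pI z(1)] by simp
    note ft = exchange_vertex_full[OF full z(1) c]
    have np: "p \<notin> s - {z}" by (rule exchange_vertex_notin[OF full z(1) c])
    have vt: "v \<in> ?t" "w \<in> ?t" "p \<in> ?t" "p \<noteq> v" "p \<noteq> w" using vs ws z np by auto
    have bt: "bary ?t y u = (1 - a) * (1 - b) * (if u = p then 1 else 0)
        + a * (1 - b) * (if u = v then 1 else 0) + b * (if u = w then 1 else 0)" if "u \<in> ?t" for u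
    proof -
      have "bary ?t y u = bary ?t x u + b * (bary ?t w u - bary ?t x u)"
        "bary ?t x u = bary ?t p u + a * (bary ?t v u - bary ?t p u)"
        unfolding yeq xeq by (rule bary_segment[OF ft that])+
      then have "bary ?t y u = (1 - a) * (1 - b) * bary ?t p u + a * (1 - b) * bary ?t v u + b * bary ?t w u"
        by algebra
      then show ?thesis
        by (simp only: bary_vertex[OF ft that vt(1)] bary_vertex[OF ft that vt(2)] bary_vertex[OF ft that vt(3)])
    qed
    have ab: "0 < (1 - a) * (1 - b)" "0 < a * (1 - b)" using a b by auto
    have "supp ?t y = {p, v, w}"
    proof (rule set_eqI)
      fix u
      show "u \<in> supp ?t y \<longleftrightarrow> u \<in> {p, v, w}"
      proof (cases "u \<in> ?t")
        case True
        then show ?thesis using bt[OF True] ab b vw vt by (auto simp: supp_def)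
      next
        case False
        then show ?thesis using vt(1-3) by (auto simp: supp_def)
      qed
    qed
    moreover have "card {p, v, w} = 3" using vt vw by simp
    moreover have "y \<in> convex hull ?t"
      unfolding convex_hull_bary[OF ft] using bt ab b by auto
    moreover have "y \<noteq> p"
    proof
      assume "y = p"
      then have "bary ?t y v = 0" using bary_vertex[OF ft vt(1,3)] vt(4) by simp
      then show False using bt[OF vt(1)] vw vt ab by auto
    qed
    moreover have "?t \<in> star_subdivision s p"
      using z(1) int[OF pI z(1)] by (auto simp: star_subdivision_def supp_def)
    ultimately have "3 - 1 \<in> {1, CARD('n)}"
      using tight_second_point[OF s pI yI, of ?t] by metis
    then show False using n3 by simp
  qed
  obtain p x v a where p: "p \<in> ?I" and x: "x \<in> ?I" and v: "v \<in> s"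
    and a: "0 < a" "a < 1" "x = p + a *\<^sub>R (v - p)"
    using ne succ by (metis ex_in_conv)
  \<comment> \<open>Points that are themselves reached by a step towards \<open>v\<close>: their next step must aim at \<open>v\<close> again.\<close>
  let ?R = "{y \<in> ?I. \<exists>q\<in>?I. \<exists>r. 0 < r \<and> r < 1 \<and> y = q + r *\<^sub>R (v - q)}"
  have "finite ?R" using finite_interior_lattice_points[OF full] by simp
  moreover have "?R \<noteq> {}" using p x a by blast
  ultimately obtain y where "is_arg_min (\<lambda>y. - bary s y v) (\<lambda>y. y \<in> ?R) y"
    using ex_is_arg_min_if_finite[of ?R "\<lambda>y. - bary s y v"] by blast
  then have yR: "y \<in> ?R" and max: "\<And>z. z \<in> ?R \<Longrightarrow> bary s z v \<le> bary s y v"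
    unfolding is_arg_min_linorder by auto
  obtain q r where q: "q \<in> ?I" "0 < r" "r < 1" "y = q + r *\<^sub>R (v - q)" using yR by blast
  have yI: "y \<in> ?I" using yR by blast
  obtain z w b where z: "z \<in> ?I" "w \<in> s" "0 < b" "b < 1" "z = y + b *\<^sub>R (w - y)"
    using succ[OF yI] by blast
  have "v = w" using same[OF q(1) yI z(1) v z(2) q(2,3,4) z(3,4,5)] .
  then have "z \<in> ?R" using z yI by blast
  have "bary s z v = bary s y v + b * (1 - bary s y v)"
    using bary_segment[OF full v, of y b v] bary_vertex[OF full v v] z(5) \<open>v = w\<close> by simp
  moreover have "bary s y v < 1"
  proof -
    have "bary s y v = bary s q v + r * (1 - bary s q v)"
      using bary_segment[OF full v, of q r v] bary_vertex[OF full v v] q(4) by simp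
    moreover have "bary s q v < 1"
    proof -
      have "card s \<noteq> 1" using full by (simp add: full_simplex_def)
      then have "s - {v} \<noteq> {}" using v by (auto simp: card_1_singleton_iff)
      then have "0 < sum (bary s q) (s - {v})"
        using int[OF q(1)] full_simplex_finite[OF full] by (intro sum_pos) auto
      then show ?thesis
        using sum.remove[OF full_simplex_finite[OF full] v, of "bary s q"] sum_bary[OF full, of q] by simp
    qed
    ultimately have "1 - bary s y v = (1 - r) * (1 - bary s q v)" by (simp add: algebra_simps)
    moreover have "0 < (1 - r) * (1 - bary s q v)" using q \<open>bary s q v < 1\<close> by simp
    ultimately show ?thesis by simp
  qed
  ultimately have "bary s y v < bary s z v" using z(3) by simp
  then show False using max[OF \<open>z \<in> ?R\<close>] by simp
qed

text \<open>
  Take \<open>p\<close> as in \<open>exists_extremal_point\<close> if \<open>n \<ge> 3\<close>, and any interior lattice point if \<open>n = 1\<close>.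
  Another interior lattice point \<open>x\<close> in a simplex of the star subdivision at \<open>p\<close> is interior to that
  simplex or to one of its edges. Such an edge would contain \<open>p\<close>, because edges without \<open>p\<close> are on
  the boundary of \<open>s\<close>, and this is excluded by the choice of \<open>p\<close>. So the other interior lattice
  points are distributed over the interiors of the pieces; the lower bounds for the volumes of the
  pieces add up to the volume of \<open>s\<close>, and each of them is attained.
\<close>

lemma tight_split:
  fixes s :: "(real^'n) set"
  assumes s: "tight s" and ne: "interior_lattice_points (convex hull s) \<noteq> {}" and n2: "CARD('n) \<noteq> 2"
  shows "\<exists>p\<in>interior_lattice_points (convex hull s).
    (\<forall>v\<in>s. tight (insert p (s - {v}))) \<and>
    card (interior_lattice_points (convex hull s)) =
      1 + (\<Sum>v\<in>s. card (interior_lattice_points (convex hull (insert p (s - {v})))))"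
proof -
  let ?I = "interior_lattice_points (convex hull s)"
  note full = tight_imp_full[OF s]
  note fin = full_simplex_finite[OF full]
  have finI: "finite ?I" by (rule finite_interior_lattice_points[OF full])
  have int: "0 < bary s p v" if "p \<in> ?I" "v \<in> s" for p v
    using that by (simp add: interior_lattice_points_def interior_convex_hull_bary[OF full])
  have "\<exists>p\<in>?I. 3 \<le> CARD('n) \<longrightarrow> (\<forall>x\<in>?I. \<forall>v\<in>s. \<forall>r>0. r < 1 \<longrightarrow> x \<noteq> p + r *\<^sub>R (v - p))"
    using exists_extremal_point[OF s ne] ne by (cases "3 \<le> CARD('n)") auto
  then obtain p where p: "p \<in> ?I"
    and ext: "\<And>x v r. 3 \<le> CARD('n) \<Longrightarrow> x \<in> ?I \<Longrightarrow> v \<in> s \<Longrightarrow> 0 < r \<Longrightarrow> r < 1 \<Longrightarrow> x \<noteq> p + r *\<^sub>R (v - p)"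
    by blast
  let ?t = "\<lambda>v. insert p (s - {v})"
  have pint: "p \<in> interior (convex hull s)" "p \<in> integer_lattice" and pin: "p \<in> convex hull s"
    using p interior_subset by (auto simp: interior_lattice_points_def)
  have star: "star_subdivision s p = ?t ` s"
    using supp_interior[OF full, of p] pint by (simp add: star_subdivision_def)
  have inj: "inj_on ?t s"
    using star_subdivision_inj[OF full, of p] supp_interior[OF full, of p] pint by simp
  have D: "dissection (?t ` s) (convex hull s)"
    using dissection_star_subdivision[OF full pin] star by simp
  have ft: "full_simplex (?t v)" if "v \<in> s" for v
    using dissectionD(2)[OF D] that by blast
  have lat: "lattice_simplex (?t v)" if "v \<in> s" for v
    using ft[OF that] s pint by (auto simp: lattice_simplex_def tight_def)
  have good: "x \<in> interior (convex hull (?t v))"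
    if x: "x \<in> ?I" "x \<noteq> p" and v: "v \<in> s" and xt: "x \<in> convex hull (?t v)" for x v
  proof -
    have "card (supp (?t v) x) - 1 \<in> {1, CARD('n)}"
      using tight_second_point[OF s p x _ xt] star v by blast
    moreover have "m - 1 = k \<or> (m = 2 \<and> 3 \<le> k)" if "m - 1 \<in> {1, k}" "k \<noteq> 2" "0 < k" for m k :: nat
      using that by auto
    ultimately consider "card (supp (?t v) x) - 1 = CARD('n)" | "card (supp (?t v) x) = 2" "3 \<le> CARD('n)"
      using n2 zero_less_card_finite[where 'a='n] by blast
    then show ?thesis
    proof cases
      case 1
      have sub: "supp (?t v) x \<subseteq> ?t v" by (auto simp: supp_def)
      have "0 < CARD('n)" by simp
      then have "card (supp (?t v) x) = Suc CARD('n)" using 1 by linarith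
      then have "card (supp (?t v) x) \<ge> card (?t v)"
        using ft[OF v] by (simp add: full_simplex_def)
      then have "supp (?t v) x = ?t v"
        using card_seteq[OF full_simplex_finite[OF ft[OF v]] sub] by blast
      then show ?thesis using supp_interior[OF ft[OF v]] by blast
    next
      case 2
      have c: "bary s p v \<noteq> 0" "0 < bary s p v" using int[OF p v] by auto
      have "0 < bary (?t v) x p"
        using exchange_vertex_new[OF full v c(1), of x] int[OF x(1) v] c(2) by simp
      then have psupp: "p \<in> supp (?t v) x" by (simp add: supp_def)
      obtain a b where ab: "supp (?t v) x = {a, b}" "a \<noteq> b" using 2(1) unfolding card_2_iff by blast
      obtain u where u: "supp (?t v) x = {p, u}" "u \<noteq> p"
      proof (cases "p = a")
        case True
        then show ?thesis using that[of b] ab by simp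
      next
        case False
        then have "p = b" using psupp ab(1) by simp
        then show ?thesis using that[of a] ab by (simp add: insert_commute)
      qed
      have us: "u \<in> s - {v}" using u by (auto simp: supp_def)
      have sup: "0 < bary (?t v) x u" using u by (auto simp: supp_def)
      have zero: "bary (?t v) x w = 0" if "w \<in> ?t v" "w \<notin> {p, u}" for w
        using xt that u(1) unfolding convex_hull_bary[OF ft[OF v]] supp_def by force
      have sub: "{p, u} \<subseteq> ?t v" "finite (?t v)" using us fin by auto
      have "sum (bary (?t v) x) (?t v) = sum (bary (?t v) x) {p, u}"
        using zero by (intro sum.mono_neutral_right sub) auto
      then have sum1: "bary (?t v) x p = 1 - bary (?t v) x u"
        using sum_bary[OF ft[OF v], of x] u(2) by simp
      have "(\<Sum>w\<in>?t v. bary (?t v) x w *\<^sub>R w) = (\<Sum>w\<in>{p, u}. bary (?t v) x w *\<^sub>R w)"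
        using zero by (intro sum.mono_neutral_right sub) auto
      then have "x = bary (?t v) x p *\<^sub>R p + bary (?t v) x u *\<^sub>R u"
        using bary_combination[OF ft[OF v], of x] u(2) by simp
      then have "x = p + bary (?t v) x u *\<^sub>R (u - p)"
        unfolding sum1 by (simp add: algebra_simps)
      moreover have "bary (?t v) x u < 1" using sum1 \<open>0 < bary (?t v) x p\<close> by simp
      ultimately show ?thesis using ext[OF 2(2) x(1) _ sup] us by blast
    qed
  qed
  let ?J = "\<lambda>v. interior_lattice_points (convex hull (?t v))"
  have J: "?J v = (?I - {p}) \<inter> convex hull (?t v)" if v: "v \<in> s" for v
  proof -
    have "interior (convex hull (?t v)) \<subseteq> interior (convex hull s)"
      using dissectionD(5)[OF D, of "?t v"] v by (intro interior_mono) blast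
    moreover have "p \<notin> interior (convex hull (?t v))"
      using vertex_notin_interior[OF ft[OF v]] by blast
    ultimately show ?thesis
      using good[OF _ _ v] interior_subset[of "convex hull (?t v)"]
      unfolding interior_lattice_points_def by auto
  qed
  have disj: "?J v \<inter> ?J w = {}" if "v \<in> s" "w \<in> s" "v \<noteq> w" for v w
  proof -
    have "?t v \<noteq> ?t w" using inj that by (auto dest: inj_onD)
    then show ?thesis
      using dissectionD(4)[OF D, of "?t v" "?t w"] that unfolding interior_lattice_points_def by blast
  qed
  have "(\<Union>v\<in>s. ?J v) = ?I - {p}"
  proof -
    have "(\<Union>v\<in>s. ?J v) = (?I - {p}) \<inter> (\<Union>v\<in>s. convex hull (?t v))" using J by blast
    also have "(\<Union>v\<in>s. convex hull (?t v)) = convex hull s" using dissectionD(3)[OF D] by simp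
    finally show ?thesis
      using interior_subset[of "convex hull s"] unfolding interior_lattice_points_def by blast
  qed
  moreover have "card (\<Union>v\<in>s. ?J v) = (\<Sum>v\<in>s. card (?J v))"
    using fin finite_interior_lattice_points[OF ft] disj by (intro card_UN_disjoint) auto
  ultimately have count: "card ?I = 1 + (\<Sum>v\<in>s. card (?J v))"
    using card_Suc_Diff1[OF finI p] by simp
  have lower: "real (CARD('n) * card (?J v) + 1) \<le> nvol (convex hull (?t v))" if v: "v \<in> s" for v
    using nvol_lower_bound[OF finite_interior_lattice_points[OF ft[OF v]]
        lattice_dissection_singleton[OF lat[OF v]]] vertex_notin_interior[OF ft[OF v]]
    by (auto simp: interior_lattice_points_def)
  have "(\<Sum>v\<in>s. nvol (convex hull (?t v))) = nvol (convex hull s)"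
    using nvol_dissection[OF D] by (simp add: sum.reindex[OF inj])
  also have "\<dots> = real (CARD('n) * card ?I + 1)" using s by (simp add: tight_def)
  also have "\<dots> = (\<Sum>v\<in>s. real (CARD('n) * card (?J v) + 1))"
    using full unfolding count by (simp add: full_simplex_def sum.distrib sum_distrib_left algebra_simps)
  finally have "(\<Sum>v\<in>s. nvol (convex hull (?t v)) - real (CARD('n) * card (?J v) + 1)) = 0"
    by (simp add: sum_subtractf)
  then have "nvol (convex hull (?t v)) - real (CARD('n) * card (?J v) + 1) = 0" if "v \<in> s" for v
    using sum_nonneg_0[OF fin, of "\<lambda>v. nvol (convex hull (?t v)) - real (CARD('n) * card (?J v) + 1)" v]
      lower that by simp
  then have "\<forall>v\<in>s. tight (?t v)" using lat by (simp add: tight_def)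
  then show ?thesis using p count by blast
qed

section \<open>Half-open dissections\<close>

text \<open>
  Decide the membership of boundary points by moving them slightly towards \<open>q\<close>. For a simplex and
  generic \<open>q\<close> this removes exactly the facets that separate \<open>q\<close> from the simplex
  (\<open>mem_half_open_simplex\<close>).
\<close>

definition half_open :: "'a::euclidean_space \<Rightarrow> 'a set \<Rightarrow> 'a set" where
  "half_open q K = {x. \<forall>\<^sub>F e in at_right (0::real). x + e *\<^sub>R (q - x) \<in> interior K}"

lemma eventually_affine_sign:
  fixes b c :: real
  assumes "c \<noteq> 0"
  shows "0 < b \<or> (b = 0 \<and> 0 < c) \<Longrightarrow> \<forall>\<^sub>F e in at_right 0. 0 < b + e * (c - b)"
    and "\<not> (0 < b \<or> (b = 0 \<and> 0 < c)) \<Longrightarrow> \<forall>\<^sub>F e in at_right 0. b + e * (c - b) < 0"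
proof -
  have lim: "((\<lambda>e. b + e * (c - b)) \<longlongrightarrow> b) (at_right 0)"
    by (auto intro!: tendsto_eq_intros)
  have pos: "\<forall>\<^sub>F e in at_right (0::real). 0 < e" by (rule eventually_at_right_less)
  show "\<forall>\<^sub>F e in at_right 0. 0 < b + e * (c - b)" if "0 < b \<or> (b = 0 \<and> 0 < c)"
  proof (cases "0 < b")
    case True
    then show ?thesis using order_tendstoD(1)[OF lim] by blast
  next
    case False
    then show ?thesis using that by (intro eventually_mono[OF pos]) auto
  qed
  show "\<forall>\<^sub>F e in at_right 0. b + e * (c - b) < 0" if "\<not> (0 < b \<or> (b = 0 \<and> 0 < c))"
  proof (cases "b < 0")
    case True
    then show ?thesis using order_tendstoD(2)[OF lim] by blast
  next
    case False
    then have "b = 0" "c < 0" using that assms by auto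
    then show ?thesis by (intro eventually_mono[OF pos]) (auto simp: mult_pos_neg)
  qed
qed

text \<open>
  Along the segment from \<open>x\<close> to \<open>q\<close> each coordinate is an affine function that does not vanish
  identically, so its sign is eventually constant. In particular the moved point is either
  eventually in the interior or eventually outside.
\<close>

lemma
  assumes s: "full_simplex s" and q: "\<And>u. u \<in> s \<Longrightarrow> bary s q u \<noteq> 0"
  shows mem_half_open_simplex: "x \<in> half_open q (convex hull s) \<longleftrightarrow>
      (\<forall>v\<in>s. 0 < bary s x v \<or> (bary s x v = 0 \<and> 0 < bary s q v))"
    and notin_half_open_simplex: "x \<notin> half_open q (convex hull s) \<Longrightarrow>
      \<forall>\<^sub>F e in at_right 0. x + e *\<^sub>R (q - x) \<notin> convex hull s"
proof -
  let ?P = "\<lambda>v. 0 < bary s x v \<or> (bary s x v = 0 \<and> 0 < bary s q v)"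
  note fin = full_simplex_finite[OF s]
  have inside: "x \<in> half_open q (convex hull s)" if P: "\<forall>v\<in>s. ?P v"
  proof -
    have "\<forall>\<^sub>F e in at_right 0. \<forall>v\<in>s. 0 < bary s x v + e * (bary s q v - bary s x v)"
      using P q by (intro eventually_ball_finite[OF fin] ballI eventually_affine_sign(1)) auto
    then show ?thesis
      unfolding half_open_def interior_convex_hull_bary[OF s]
      by (auto simp: bary_segment[OF s] elim!: eventually_mono)
  qed
  have outside: "\<forall>\<^sub>F e in at_right 0. x + e *\<^sub>R (q - x) \<notin> convex hull s" if nP: "\<not> (\<forall>v\<in>s. ?P v)"
  proof -
    obtain v where v: "v \<in> s" "\<not> ?P v" using nP by blast
    have "\<forall>\<^sub>F e in at_right 0. bary s x v + e * (bary s q v - bary s x v) < 0"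
      using v q by (intro eventually_affine_sign(2)) auto
    then show ?thesis
    proof (rule eventually_mono)
      fix e assume "bary s x v + e * (bary s q v - bary s x v) < 0"
      then have "bary s (x + e *\<^sub>R (q - x)) v < 0" using bary_segment[OF s v(1)] by simp
      then show "x + e *\<^sub>R (q - x) \<notin> convex hull s"
        using v(1) by (force simp: convex_hull_bary[OF s])
    qed
  qed
  have "x \<notin> half_open q (convex hull s)" if nP: "\<not> (\<forall>v\<in>s. ?P v)"
  proof
    assume "x \<in> half_open q (convex hull s)"
    then have "\<forall>\<^sub>F e in at_right 0. x + e *\<^sub>R (q - x) \<in> interior (convex hull s)"
      by (simp add: half_open_def)
    with outside[OF nP] have "\<forall>\<^sub>F e in at_right (0::real). False"
      by eventually_elim (use interior_subset in blast)
    then show False by simp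
  qed
  then show "x \<in> half_open q (convex hull s) \<longleftrightarrow> (\<forall>v\<in>s. ?P v)" using inside by blast
  then show "x \<notin> half_open q (convex hull s) \<Longrightarrow>
      \<forall>\<^sub>F e in at_right 0. x + e *\<^sub>R (q - x) \<notin> convex hull s" using outside by blast
qed

text \<open>
  The gain from half-open simplices: they tile without overlaps. A point moved slightly towards \<open>q\<close>
  is eventually in the interior of exactly one simplex.
\<close>

lemma half_open_dissection:
  assumes T: "dissection T K" and q: "\<And>s u. s \<in> T \<Longrightarrow> u \<in> s \<Longrightarrow> bary s q u \<noteq> 0"
  shows "half_open q K = (\<Union>s\<in>T. half_open q (convex hull s))"
    and "s \<in> T \<Longrightarrow> t \<in> T \<Longrightarrow> s \<noteq> t \<Longrightarrow> half_open q (convex hull s) \<inter> half_open q (convex hull t) = {}"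
proof -
  have "x \<in> (\<Union>s\<in>T. half_open q (convex hull s))" if x: "x \<in> half_open q K" for x
  proof (rule ccontr)
    assume "x \<notin> (\<Union>s\<in>T. half_open q (convex hull s))"
    then have "\<forall>s\<in>T. \<forall>\<^sub>F e in at_right 0. x + e *\<^sub>R (q - x) \<notin> convex hull s"
      using notin_half_open_simplex[OF dissectionD(2)[OF T]] q by (metis UN_I)
    then have "\<forall>\<^sub>F e in at_right 0. \<forall>s\<in>T. x + e *\<^sub>R (q - x) \<notin> convex hull s"
      by (rule eventually_ball_finite[OF dissectionD(1)[OF T]])
    moreover have "\<forall>\<^sub>F e in at_right 0. x + e *\<^sub>R (q - x) \<in> interior K"
      using x by (simp add: half_open_def)
    ultimately have "\<forall>\<^sub>F e in at_right (0::real). False"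
      by eventually_elim (use interior_subset[of K] dissectionD(3)[OF T] in blast)
    then show False by simp
  qed
  moreover have "half_open q (convex hull s) \<subseteq> half_open q K" if "s \<in> T" for s
    using interior_mono[OF dissectionD(5)[OF T that]]
    unfolding half_open_def by (auto elim!: eventually_mono)
  ultimately show "half_open q K = (\<Union>s\<in>T. half_open q (convex hull s))" by blast
  assume st: "s \<in> T" "t \<in> T" "s \<noteq> t"
  show "half_open q (convex hull s) \<inter> half_open q (convex hull t) = {}"
  proof (rule ccontr)
    assume "half_open q (convex hull s) \<inter> half_open q (convex hull t) \<noteq> {}"
    then obtain x where "\<forall>\<^sub>F e in at_right 0. x + e *\<^sub>R (q - x) \<in> interior (convex hull s)"
      "\<forall>\<^sub>F e in at_right 0. x + e *\<^sub>R (q - x) \<in> interior (convex hull t)"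
      by (auto simp: half_open_def)
    then have "\<forall>\<^sub>F e in at_right (0::real). False"
      by eventually_elim (use dissectionD(4)[OF T st(1,2)] st(3) in blast)
    then show False by simp
  qed
qed

lemma half_open_subset:
  assumes "closed K" shows "half_open q K \<subseteq> K"
proof
  fix x assume "x \<in> half_open q K"
  then have ev: "\<forall>\<^sub>F e in at_right (0::real). x + e *\<^sub>R (q - x) \<in> K"
    unfolding half_open_def using interior_subset by (auto elim!: eventually_mono)
  have "((\<lambda>e. x + e *\<^sub>R (q - x)) \<longlongrightarrow> x) (at_right (0::real))"
    by (auto intro!: tendsto_eq_intros)
  then show "x \<in> K" using Lim_in_closed_set[OF assms ev] by simp
qed

lemma half_open_interior:
  fixes K :: "'a::euclidean_space set"
  assumes "closed K" "convex K" "q \<in> interior K"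
  shows "half_open q K = K"
proof
  show "K \<subseteq> half_open q K"
  proof
    fix x assume "x \<in> K"
    have "\<forall>\<^sub>F e in at_right (0::real). 0 < e \<and> e < 1"
      by (intro eventually_conj eventually_at_right_less eventually_at_rightI[of 0 1]) auto
    then have "\<forall>\<^sub>F e in at_right (0::real). x + e *\<^sub>R (q - x) \<in> interior K"
    proof (rule eventually_mono)
      fix e :: real assume "0 < e \<and> e < 1"
      then have "x - e *\<^sub>R (x - q) \<in> interior K"
        using mem_interior_convex_shrink[OF assms(2,3) \<open>x \<in> K\<close>, of e] by simp
      then show "x + e *\<^sub>R (q - x) \<in> interior K" by (simp add: algebra_simps)
    qed
    then show "x \<in> half_open q K" by (simp add: half_open_def)
  qed
qed (rule half_open_subset[OF assms(1)])

section \<open>Counting lattice points in dilates\<close>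

definition dilate_count :: "nat \<Rightarrow> (real^'n) set \<Rightarrow> nat" where
  "dilate_count k S = card {y \<in> integer_lattice. y /\<^sub>R real k \<in> S}"

lemma dilate_lattice_points:
  fixes S :: "(real^'n) set"
  assumes "0 < k"
  shows "{y \<in> integer_lattice. y /\<^sub>R real k \<in> S} = (\<lambda>x. real k *\<^sub>R x) ` S \<inter> integer_lattice"
proof (intro set_eqI iffI)
  fix y :: "real^'n" assume "y \<in> {y \<in> integer_lattice. y /\<^sub>R real k \<in> S}"
  then show "y \<in> (\<lambda>x. real k *\<^sub>R x) ` S \<inter> integer_lattice"
    using assms by (auto intro!: image_eqI[of _ _ "y /\<^sub>R real k"])
qed (use assms in auto)

lemma lattice_count_dilate:
  "0 < k \<Longrightarrow> lattice_count ((\<lambda>x. real k *\<^sub>R x) ` S) = dilate_count k S"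
  by (simp add: lattice_count_def dilate_count_def dilate_lattice_points)

lemma finite_dilate_lattice_points:
  assumes "0 < k" "bounded S"
  shows "finite {y \<in> integer_lattice. y /\<^sub>R real k \<in> S}"
  unfolding dilate_lattice_points[OF assms(1)]
  by (intro finite_lattice_points bounded_scaling assms)

lemma closed_convex_hull_simplex: "full_simplex s \<Longrightarrow> closed (convex hull s)"
  using full_simplex_finite[of s] by (simp add: compact_imp_closed finite_imp_compact_convex_hull)

lemma bounded_half_open_simplex:
  assumes "full_simplex s" shows "bounded (half_open q (convex hull s))"
  using half_open_subset[OF closed_convex_hull_simplex[OF assms]]
    finite_imp_bounded_convex_hull[OF full_simplex_finite[OF assms]] bounded_subset by blast

lemma dilate_count_dissection:
  assumes T: "dissection T K" and q: "\<And>s u. s \<in> T \<Longrightarrow> u \<in> s \<Longrightarrow> bary s q u \<noteq> 0" and k: "0 < k"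
  shows "dilate_count k (half_open q K) = (\<Sum>s\<in>T. dilate_count k (half_open q (convex hull s)))"
proof -
  let ?Y = "\<lambda>s. {y \<in> integer_lattice. y /\<^sub>R real k \<in> half_open q (convex hull s)}"
  have "{y \<in> integer_lattice. y /\<^sub>R real k \<in> half_open q K} = (\<Union>s\<in>T. ?Y s)"
    using half_open_dissection(1)[OF T] q by blast
  moreover have "card (\<Union>s\<in>T. ?Y s) = (\<Sum>s\<in>T. card (?Y s))"
  proof (rule card_UN_disjoint[OF dissectionD(1)[OF T]])
    show "\<forall>s\<in>T. finite (?Y s)"
      using finite_dilate_lattice_points[OF k bounded_half_open_simplex] dissectionD(2)[OF T] by blast
    show "\<forall>s\<in>T. \<forall>t\<in>T. s \<noteq> t \<longrightarrow> ?Y s \<inter> ?Y t = {}"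
      using half_open_dissection(2)[OF T] q by blast
  qed
  ultimately show ?thesis by (simp add: dilate_count_def)
qed

text \<open>
  The facets that separate \<open>q\<close> from the simplex, each represented by its opposite vertex.
\<close>

definition visible :: "'a::euclidean_space set \<Rightarrow> 'a \<Rightarrow> 'a set" where
  "visible s q = {v \<in> s. bary s q v < 0}"

lemma card_visible_le:
  fixes s :: "'a::euclidean_space set"
  assumes s: "full_simplex s" shows "card (visible s q) \<le> DIM('a)"
proof -
  have "supp s q \<inter> visible s q = {}" "supp s q \<union> visible s q \<subseteq> s" by (auto simp: supp_def visible_def)
  then have "card (supp s q) + card (visible s q) \<le> card s"
    using full_simplex_finite[OF s] card_Un_disjoint[of "supp s q" "visible s q"] card_mono[of s]
    by (metis finite_Un finite_subset)
  moreover have "0 < card (supp s q)"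
    using supp_nonempty[OF s] full_simplex_finite[OF s] by (simp add: card_gt_0_iff supp_def)
  ultimately show ?thesis using s by (simp add: full_simplex_def)
qed

text \<open>
  The lattice points of the \<open>k\<close>-th dilate correspond to the families of natural numbers, indexed by
  the vertices, with sum \<open>k\<close> and with positive entries at the visible vertices. Subtracting \<open>1\<close> from
  these entries leaves the weak compositions of \<open>k - r\<close> into \<open>n + 1\<close> parts.
\<close>

lemma unimodular_half_open_count:
  fixes s :: "(real^'n) set"
  assumes s: "lattice_simplex s" and unimod: "nvol (convex hull s) = 1"
    and q: "\<And>u. u \<in> s \<Longrightarrow> bary s q u \<noteq> 0" and k: "0 < k"
  shows "dilate_count k (half_open q (convex hull s)) =
    (k + CARD('n) - card (visible s q)) choose CARD('n)"
proof -
  have full: "full_simplex s" using s by (simp add: lattice_simplex_def)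
  note fin = full_simplex_finite[OF full]
  let ?Y = "{y \<in> integer_lattice. y /\<^sub>R real k \<in> half_open q (convex hull s)}"
  let ?b = "\<lambda>y. bary s (y /\<^sub>R real k)" and ?\<rho> = "\<lambda>v. if v \<in> visible s q then 1 else 0 :: nat"
  let ?r = "card (visible s q)"
  define m where "m = (\<lambda>y v. nat \<lfloor>real k * ?b y v\<rfloor>)"
  have Y: "y \<in> ?Y \<longleftrightarrow> y \<in> integer_lattice \<and> (\<forall>v\<in>s. 0 < ?b y v \<or> (?b y v = 0 \<and> 0 < bary s q v))" for y
    using mem_half_open_simplex[OF full] q by simp
  have m: "real (m y v) = real k * ?b y v" "?\<rho> v \<le> m y v" if y: "y \<in> ?Y" and v: "v \<in> s" for y v
  proof -
    have b: "0 \<le> ?b y v" "v \<in> visible s q \<Longrightarrow> 0 < ?b y v"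
      using y v unfolding Y visible_def by force+
    have "real k * ?b y v \<in> \<int>" using unimodular_bary_Ints[OF s unimod _ k v] y by simp
    then show eq: "real (m y v) = real k * ?b y v"
      unfolding m_def using b(1) by (auto elim!: Ints_cases)
    have "v \<in> visible s q \<Longrightarrow> 0 < real (m y v)" unfolding eq using b(2) k by simp
    then show "?\<rho> v \<le> m y v" by auto
  qed
  have m_sum: "(\<Sum>v\<in>s. m y v) = k" if y: "y \<in> ?Y" for y
  proof -
    have "real (\<Sum>v\<in>s. m y v) = (\<Sum>v\<in>s. real k * ?b y v)"
      unfolding of_nat_sum by (rule sum.cong[OF refl]) (rule m(1)[OF y])
    also have "\<dots> = real k" using sum_bary[OF full] by (simp flip: sum_distrib_left)
    finally show ?thesis by (simp only: of_nat_eq_iff)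
  qed
  have \<rho>_sum: "(\<Sum>v\<in>s. ?\<rho> v) = ?r"
    using fin by (simp add: visible_def sum.If_cases Int_def)
  obtain xs where xs: "set xs = s" "distinct xs" using finite_distinct_list[OF fin] by blast
  have len: "length xs = Suc CARD('n)" using distinct_card[OF xs(2)] full xs(1) by (simp add: full_simplex_def)
  show ?thesis
  proof (cases "?r \<le> k")
    case False
    have "?Y = {}"
    proof (rule ccontr)
      assume "?Y \<noteq> {}"
      then obtain y where y: "y \<in> ?Y" by blast
      have "(\<Sum>v\<in>s. ?\<rho> v) \<le> (\<Sum>v\<in>s. m y v)" by (rule sum_mono) (rule m(2)[OF y])
      then show False using False \<rho>_sum m_sum[OF y] by simp
    qed
    then have "dilate_count k (half_open q (convex hull s)) = 0"
      unfolding dilate_count_def by (simp only: card.empty)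
    moreover have "0 < CARD('n)" by simp
    then have "k + CARD('n) - ?r < CARD('n)" using False by linarith
    ultimately show ?thesis by (simp add: binomial_eq_0)
  next
    case True
    let ?L = "{l :: nat list. length l = Suc CARD('n) \<and> sum_list l = k - ?r}"
    let ?g = "\<lambda>y. map (\<lambda>v. m y v - ?\<rho> v) xs"
    have "bij_betw ?g ?Y ?L"
      unfolding bij_betw_def
    proof
      show "inj_on ?g ?Y"
      proof (rule inj_onI)
        fix y z assume y: "y \<in> ?Y" and z: "z \<in> ?Y" and "?g y = ?g z"
        then have "\<forall>v\<in>s. m y v - ?\<rho> v = m z v - ?\<rho> v" by (simp only: map_eq_conv xs(1))
        then have "m y v = m z v" if "v \<in> s" for v
          using m(2)[OF y that] m(2)[OF z that] that eq_diff_iff by blast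
        then have "real k * ?b y v = real k * ?b z v" if "v \<in> s" for v
          using m(1)[OF y that] m(1)[OF z that] that by metis
        then have "?b y v = ?b z v" if "v \<in> s" for v using that k by simp
        then have "y /\<^sub>R real k = z /\<^sub>R real k" by (rule bary_eqI[OF full])
        then show "y = z" using k by simp
      qed
      show "?g ` ?Y = ?L"
      proof
        have "sum_list (?g y) = k - ?r" if y: "y \<in> ?Y" for y
        proof -
          have "sum_list (?g y) = (\<Sum>v\<in>s. m y v - ?\<rho> v)"
            using sum_list_distinct_conv_sum_set[OF xs(2), of "\<lambda>v. m y v - ?\<rho> v"] xs(1) by simp
          also have "\<dots> = (\<Sum>v\<in>s. m y v) - (\<Sum>v\<in>s. ?\<rho> v)"
            by (rule sum_subtractf_nat) (rule m(2)[OF y])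
          finally show ?thesis using m_sum[OF y] \<rho>_sum by simp
        qed
        then show "?g ` ?Y \<subseteq> ?L" using len by auto
        show "?L \<subseteq> ?g ` ?Y"
        proof
          fix l assume l: "l \<in> ?L"
          define c where "c = (\<lambda>v. the (map_of (zip xs l) v))"
          have lc: "map c xs = l"
          proof (rule nth_equalityI)
            fix i assume "i < length (map c xs)"
            then show "map c xs ! i = l ! i"
              using map_of_zip_nth[of xs l i] xs(2) l len by (simp add: c_def)
          qed (use l len in simp)
          let ?u = "\<lambda>v. real (c v + ?\<rho> v)"
          define y where "y = (\<Sum>v\<in>s. ?u v *\<^sub>R v)"
          have "(\<Sum>v\<in>s. c v) = k - ?r"
            using sum_list_distinct_conv_sum_set[OF xs(2), of c] xs(1) lc l by simp
          then have "(\<Sum>v\<in>s. c v + ?\<rho> v) = k" using True \<rho>_sum by (simp add: sum.distrib)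
          then have su: "(\<Sum>v\<in>s. ?u v) = real k" by (metis (mono_tags, lifting) of_nat_sum sum.cong)
          have bu: "?b y v = ?u v / real k" if "v \<in> s" for v
          proof (rule bary_unique[OF full _ _ that])
            show "(\<Sum>v\<in>s. ?u v / real k) = 1" using su k by (simp add: sum_divide_distrib[symmetric])
            show "(\<Sum>v\<in>s. (?u v / real k) *\<^sub>R v) = y /\<^sub>R real k"
              unfolding y_def scaleR_sum_right by (simp add: divide_inverse mult.commute)
          qed
          have "y \<in> integer_lattice"
            unfolding integer_lattice_def y_def using s
            by (auto simp: lattice_simplex_def integer_lattice_def intro!: Ints_sum Ints_mult)
          moreover have "0 < ?b y v \<or> (?b y v = 0 \<and> 0 < bary s q v)" if "v \<in> s" for v
          proof (cases "v \<in> visible s q")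
            case True
            then show ?thesis using bu[OF that] k by simp
          next
            case False
            then have "0 < bary s q v" using q[OF that] that by (simp add: visible_def)
            moreover have "0 \<le> ?b y v" using bu[OF that] k by simp
            ultimately show ?thesis by linarith
          qed
          ultimately have yY: "y \<in> ?Y" unfolding Y by blast
          have "m y v = c v + ?\<rho> v" if "v \<in> s" for v
            using m(1)[OF yY that] bu[OF that] k by (simp del: of_nat_add)
          then have "?g y = map c xs" using xs by simp
          then show "l \<in> ?g ` ?Y" using yY lc by (metis (no_types, lifting) image_eqI)
        qed
      qed
    qed
    then have "card ?Y = card ?L" by (rule bij_betw_same_card)
    also have "\<dots> = (k - ?r + Suc CARD('n) - 1) choose (k - ?r)" by (rule card_length_sum_list)
    also have "\<dots> = (k + CARD('n) - ?r) choose CARD('n)"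
      using True binomial_symmetric[of "k - ?r" "k - ?r + CARD('n)"] by simp
    finally show ?thesis by (simp add: dilate_count_def)
  qed
qed

section \<open>Ehrhart polynomials of tight simplices\<close>

lemma shifted_sum:
  fixes g :: "nat \<Rightarrow> nat"
  assumes "r \<le> n"
  shows "(\<Sum>j<Suc n. g (j + (if j < r then 1 else 0))) = g r + (\<Sum>i=1..n. g i)"
  using assms
proof (induction n rule: dec_induct)
  case base
  have "(\<Sum>j<r. g (j + (if j < r then 1 else 0))) = (\<Sum>j<r. g (Suc j))" by (rule sum.cong) auto
  then show ?case by (simp add: sum.atLeast1_atMost_eq)
next
  case (step n)
  then show ?case by simp
qed

text \<open>
  This is the bookkeeping for coning a simplex from an interior point \<open>p\<close>. With \<open>\<rho> v\<close> the ratio of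
  the coordinates at \<open>v\<close> of \<open>q\<close> and \<open>p\<close>, the argument of \<open>g\<close> on the left is the number of visible
  facets of the piece in which \<open>p\<close> replaces \<open>v\<close>. Since the ratios are distinct, the ranks of the
  vertices are \<open>0, \<dots>, n\<close>, and the \<open>r\<close> lowest ones belong to negative ratios. So the numbers of
  visible facets are \<open>1, \<dots>, r\<close> and \<open>r, \<dots>, n\<close>.
\<close>

lemma rank_sum:
  fixes \<rho> :: "'a \<Rightarrow> real" and g :: "nat \<Rightarrow> nat"
  assumes A: "finite A" "card A = Suc n" and inj: "inj_on \<rho> A" and neg: "card {v \<in> A. \<rho> v < 0} \<le> n"
  shows "(\<Sum>v\<in>A. g (card {u \<in> A. \<rho> u < \<rho> v} + (if \<rho> v < 0 then 1 else 0))) =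
     g (card {v \<in> A. \<rho> v < 0}) + (\<Sum>i=1..n. g i)"
proof -
  let ?rank = "\<lambda>v. card {u \<in> A. \<rho> u < \<rho> v}" and ?r = "card {v \<in> A. \<rho> v < 0}"
  have mono: "?rank v < ?rank w" if "v \<in> A" "w \<in> A" "\<rho> v < \<rho> w" for v w
  proof (rule psubset_card_mono)
    show "finite {u \<in> A. \<rho> u < \<rho> w}" using A by simp
    have "v \<in> {u \<in> A. \<rho> u < \<rho> w} - {u \<in> A. \<rho> u < \<rho> v}" using that by simp
    moreover have "{u \<in> A. \<rho> u < \<rho> v} \<subseteq> {u \<in> A. \<rho> u < \<rho> w}" using that by auto
    ultimately show "{u \<in> A. \<rho> u < \<rho> v} \<subset> {u \<in> A. \<rho> u < \<rho> w}" by blast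
  qed
  have rank_inj: "inj_on ?rank A"
  proof (rule inj_onI)
    fix v w assume vw: "v \<in> A" "w \<in> A" "?rank v = ?rank w"
    then have "\<not> \<rho> v < \<rho> w" "\<not> \<rho> w < \<rho> v" using mono[of v w] mono[of w v] by auto
    then show "v = w" using inj vw by (auto dest: inj_onD)
  qed
  have "?rank v < Suc n" if "v \<in> A" for v
  proof -
    have "{u \<in> A. \<rho> u < \<rho> v} \<subset> A" using that by auto
    then show ?thesis using psubset_card_mono[OF A(1)] A(2) by metis
  qed
  then have "?rank ` A \<subseteq> {..<Suc n}" by auto
  then have img: "?rank ` A = {..<Suc n}"
    using card_image[OF rank_inj] A(2) by (intro card_subset_eq) auto
  have sgn: "\<rho> v < 0 \<longleftrightarrow> ?rank v < ?r" if v: "v \<in> A" for v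
  proof
    assume "\<rho> v < 0"
    then have "{u \<in> A. \<rho> u < \<rho> v} \<subset> {u \<in> A. \<rho> u < 0}" using v by (auto intro: less_trans)
    then show "?rank v < ?r" using A(1) by (intro psubset_card_mono) auto
  next
    assume less: "?rank v < ?r"
    show "\<rho> v < 0"
    proof (rule ccontr)
      assume "\<not> \<rho> v < 0"
      then have "{u \<in> A. \<rho> u < 0} \<subseteq> {u \<in> A. \<rho> u < \<rho> v}" by auto
      then have "?r \<le> ?rank v" using A(1) by (intro card_mono) auto
      then show False using less by simp
    qed
  qed
  have "(\<Sum>v\<in>A. g (?rank v + (if \<rho> v < 0 then 1 else 0))) =
      (\<Sum>v\<in>A. g (?rank v + (if ?rank v < ?r then 1 else 0)))"
    by (rule sum.cong) (simp_all add: sgn)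
  also have "\<dots> = (\<Sum>j\<in>?rank ` A. g (j + (if j < ?r then 1 else 0)))"
    by (simp add: sum.reindex[OF rank_inj])
  also have "\<dots> = g ?r + (\<Sum>i=1..n. g i)" unfolding img by (rule shifted_sum[OF neg])
  finally show ?thesis .
qed

definition generic :: "(real^'n) set \<Rightarrow> real^'n \<Rightarrow> bool" where
  "generic K q \<longleftrightarrow> (\<forall>t. lattice_simplex t \<and> t \<subseteq> K \<longrightarrow> (\<forall>u\<in>t. bary t q u \<noteq> 0))"

lemma genericD: "generic K q \<Longrightarrow> lattice_simplex t \<Longrightarrow> t \<subseteq> K \<Longrightarrow> u \<in> t \<Longrightarrow> bary t q u \<noteq> 0"
  by (simp add: generic_def)

text \<open>
  Only finitely many lattice simplices fit into the bounded set \<open>K\<close>, and each of their facets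
  excludes a hyperplane.
\<close>

lemma exists_generic:
  fixes K :: "(real^'n) set"
  assumes K: "bounded K" "interior K \<noteq> {}"
  shows "\<exists>q\<in>interior K. generic K q"
proof -
  let ?T = "{t. lattice_simplex t \<and> t \<subseteq> K}"
  let ?Bad = "\<Union>t\<in>?T. \<Union>u\<in>t. {q. bary t q u = 0}"
  have "?T \<subseteq> Pow (K \<inter> integer_lattice)" by (auto simp: lattice_simplex_def)
  then have "finite ?T" using finite_lattice_points[OF K(1)] finite_subset by blast
  moreover have "negligible {q. bary t q u = 0}" if t: "full_simplex t" and u: "u \<in> t" for t u
  proof -
    have "{q. bary t q u = 0} = {q. bary_grad t u \<bullet> q = bary_grad t u \<bullet> u - 1}"
      using bary_grad[OF t u, of _ u] bary_vertex[OF t u u] by (auto simp: inner_diff_right)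
    moreover have "bary_grad t u \<noteq> 0 \<or> bary_grad t u \<bullet> u - 1 \<noteq> 0" by auto
    ultimately show ?thesis using negligible_hyperplane by metis
  qed
  ultimately have "negligible ?Bad"
    by (intro negligible_Union) (auto simp: lattice_simplex_def full_simplex_finite intro!: negligible_Union)
  moreover have "\<not> negligible (interior K)" using K(2) by (intro open_not_negligible) auto
  ultimately have "\<not> interior K \<subseteq> ?Bad" using negligible_subset by blast
  then show ?thesis unfolding generic_def by blast
qed

text \<open>
  Induction on the number of interior lattice points, splitting the simplex by \<open>tight_split\<close>.
  Genericity is required with respect to a set \<open>K\<close> around the simplex so that it passes on to the
  pieces.
\<close>

lemma tight_half_open_count:
  fixes s :: "(real^'n) set"
  assumes "tight s" and n2: "CARD('n) \<noteq> 2" and "generic K q" "s \<subseteq> K" "convex K" and k: "0 < k"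
  shows "dilate_count k (half_open q (convex hull s)) =
    ((k + CARD('n) - card (visible s q)) choose CARD('n)) +
    card (interior_lattice_points (convex hull s)) * (\<Sum>i=1..CARD('n). (k + CARD('n) - i) choose CARD('n))"
  using assms(1,4)
proof (induction "card (interior_lattice_points (convex hull s))" arbitrary: s rule: less_induct)
  case less
  let ?I = "\<lambda>s. interior_lattice_points (convex hull s)" and ?g = "\<lambda>r. (k + CARD('n) - r) choose CARD('n)"
  note full = tight_imp_full[OF less.prems(1)]
  note fin = full_simplex_finite[OF full]
  have lat: "lattice_simplex s" using less.prems(1) by (simp add: tight_def)
  have hullK: "convex hull s \<subseteq> K" using less.prems(2) assms(5) by (rule hull_minimal)
  show ?case
  proof (cases "?I s = {}")
    case True
    then have "nvol (convex hull s) = 1" using less.prems(1) by (simp add: tight_def)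
    from unimodular_half_open_count[OF lat this _ k] genericD[OF assms(3) lat less.prems(2)] True
    show ?thesis by simp
  next
    case False
    obtain p where p: "p \<in> ?I s" and t: "\<And>v. v \<in> s \<Longrightarrow> tight (insert p (s - {v}))"
      and count: "card (?I s) = 1 + (\<Sum>v\<in>s. card (?I (insert p (s - {v}))))"
      using tight_split[OF less.prems(1) False n2] by blast
    let ?t = "\<lambda>v. insert p (s - {v})"
    have pint: "p \<in> interior (convex hull s)" and pin: "p \<in> convex hull s"
      using p interior_subset by (auto simp: interior_lattice_points_def)
    have c: "0 < bary s p v" "bary s p v \<noteq> 0" if "v \<in> s" for v
      using pint that by (force simp: interior_convex_hull_bary[OF full])+
    have star: "star_subdivision s p = ?t ` s"
      using supp_interior[OF full, of p] pint by (simp add: star_subdivision_def)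
    have inj: "inj_on ?t s"
      using star_subdivision_inj[OF full, of p] supp_interior[OF full, of p] pint by simp
    have D: "dissection (?t ` s) (convex hull s)"
      using dissection_star_subdivision[OF full pin] star by simp
    have tK: "?t v \<subseteq> K" for v using less.prems(2) pin hullK by blast
    have tlat: "lattice_simplex (?t v)" if "v \<in> s" for v using t[OF that] by (simp add: tight_def)
    have gen: "bary (?t v) q u \<noteq> 0" if "v \<in> s" "u \<in> ?t v" for u v
      using genericD[OF assms(3) tlat[OF that(1)] tK that(2)] .
    let ?\<rho> = "\<lambda>v. bary s q v / bary s p v"
    have bt: "bary (?t v) q p = ?\<rho> v" if v: "v \<in> s" for v
      using exchange_vertex_new[OF full v c(2)[OF v]] .
    have bu: "bary (?t v) q u = bary s p u * (?\<rho> u - ?\<rho> v)" if v: "v \<in> s" and u: "u \<in> s - {v}" for u v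
      using exchange_vertex_old[OF full v c(2)[OF v] u, of q] c(2)[of u] u by (simp add: right_diff_distrib)
    have \<rho>inj: "inj_on ?\<rho> s"
    proof (rule inj_onI, rule ccontr)
      fix u v assume uv: "u \<in> s" "v \<in> s" "?\<rho> u = ?\<rho> v" "u \<noteq> v"
      then have "bary (?t v) q u = 0" using bu[of v u] by simp
      then show False using gen[of v u] uv by simp
    qed
    have vis: "card (visible (?t v) q) = card {u \<in> s. ?\<rho> u < ?\<rho> v} + (if ?\<rho> v < 0 then 1 else 0)"
      if v: "v \<in> s" for v
    proof -
      have np: "p \<notin> s - {v}" by (rule exchange_vertex_notin[OF full v c(2)[OF v]])
      have old: "bary (?t v) q u < 0 \<longleftrightarrow> ?\<rho> u < ?\<rho> v" if "u \<in> s - {v}" for u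
        unfolding bu[OF v that] using c(1)[of u] that by (simp add: mult_less_0_iff)
      have "visible (?t v) q = {u \<in> s - {v}. ?\<rho> u < ?\<rho> v} \<union> (if ?\<rho> v < 0 then {p} else {})"
        unfolding visible_def using bt[OF v] old by auto
      also have "{u \<in> s - {v}. ?\<rho> u < ?\<rho> v} = {u \<in> s. ?\<rho> u < ?\<rho> v}" by auto
      finally have eq: "visible (?t v) q = {u \<in> s. ?\<rho> u < ?\<rho> v} \<union> (if ?\<rho> v < 0 then {p} else {})" .
      have "p \<notin> {u \<in> s. ?\<rho> u < ?\<rho> v}" using np by auto
      then show ?thesis unfolding eq using fin by simp
    qed
    have "{v \<in> s. ?\<rho> v < 0} = visible s q"
      unfolding visible_def using c(1) by (auto simp: divide_less_0_iff dest: less_asym)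
    then have ranks: "(\<Sum>v\<in>s. ?g (card (visible (?t v) q))) = ?g (card (visible s q)) + (\<Sum>i=1..CARD('n). ?g i)"
      using rank_sum[OF fin _ \<rho>inj, of "CARD('n)" ?g] card_visible_le[OF full, of q] full vis
      by (simp add: full_simplex_def)
    have IH: "dilate_count k (half_open q (convex hull (?t v))) =
        ?g (card (visible (?t v) q)) + card (?I (?t v)) * (\<Sum>i=1..CARD('n). ?g i)" if v: "v \<in> s" for v
    proof (rule less.hyps[OF _ t[OF v] tK])
      have "card (?I (?t v)) \<le> (\<Sum>v\<in>s. card (?I (?t v)))"
        using fin v by (intro member_le_sum) auto
      then show "card (?I (?t v)) < card (?I s)" using count by simp
    qed
    have "dilate_count k (half_open q (convex hull s)) = (\<Sum>t\<in>?t ` s. dilate_count k (half_open q (convex hull t)))"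
      using gen by (intro dilate_count_dissection[OF D _ k]) auto
    also have "\<dots> = (\<Sum>v\<in>s. dilate_count k (half_open q (convex hull (?t v))))"
      by (simp add: sum.reindex[OF inj])
    also have "\<dots> = (\<Sum>v\<in>s. ?g (card (visible (?t v) q)) + card (?I (?t v)) * (\<Sum>i=1..CARD('n). ?g i))"
      by (rule sum.cong[OF refl IH])
    also have "\<dots> = ?g (card (visible s q)) + card (?I s) * (\<Sum>i=1..CARD('n). ?g i)"
      unfolding sum.distrib ranks count by (simp add: sum_distrib_right[symmetric])
    finally show ?thesis .
  qed
qed

lemma interior_visible:
  assumes "full_simplex s" "q \<in> interior (convex hull s)"
  shows "visible s q = {}"
  using assms(2) unfolding interior_convex_hull_bary[OF assms(1)] visible_def by (auto dest: less_asym)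

lemma half_open_interior_simplex:
  assumes "full_simplex s" "q \<in> interior (convex hull s)"
  shows "half_open q (convex hull s) = convex hull s"
  using half_open_interior[OF closed_convex_hull_simplex[OF assms(1)] convex_convex_hull assms(2)] .

lemma sum_by_value_le_2:
  fixes g r :: "_ \<Rightarrow> nat"
  assumes "finite T" "\<And>s. s \<in> T \<Longrightarrow> r s \<le> 2"
  shows "(\<Sum>s\<in>T. g (r s)) = card {s \<in> T. r s = 0} * g 0 + card {s \<in> T. r s = 1} * g 1 + card {s \<in> T. r s = 2} * g 2"
proof -
  have "(\<Sum>s\<in>T. g (r s)) = (\<Sum>s\<in>T. (if r s = 0 then g 0 else 0) + (if r s = 1 then g 1 else 0) + (if r s = 2 then g 2 else 0))"
  proof (rule sum.cong[OF refl])
    fix s assume "s \<in> T"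
    then have "r s = 0 \<or> r s = 1 \<or> r s = 2" using assms(2)[of s] by auto
    then show "g (r s) = (if r s = 0 then g 0 else 0) + (if r s = 1 then g 1 else 0) + (if r s = 2 then g 2 else 0)"
      by auto
  qed
  also have "\<dots> = card {s \<in> T. r s = 0} * g 0 + card {s \<in> T. r s = 1} * g 1 + card {s \<in> T. r s = 2} * g 2"
    unfolding sum.distrib by (simp add: sum.inter_filter[OF assms(1), symmetric])
  finally show ?thesis .
qed

text \<open>
  In a unimodular dissection let \<open>h\<^sub>r\<close> be the number of triangles with \<open>r\<close> visible edges. The point
  \<open>q\<close> is interior to exactly one triangle, so \<open>h\<^sub>0 = 1\<close>. The lattice points of the triangle itself
  are the three vertices and the \<open>l\<close> interior points; counted by half-open triangles their number is
  \<open>3 h\<^sub>0 + h\<^sub>1\<close>, so \<open>h\<^sub>1 = l\<close>. All triangles together number \<open>2 l + 1\<close>, so \<open>h\<^sub>2 = l\<close>.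
\<close>

lemma tight_triangle_count:
  fixes s :: "(real^'n) set"
  assumes s: "tight s" and n2: "CARD('n) = 2" and k: "0 < k"
  shows "dilate_count k (convex hull s) = ((k + 2) choose 2) +
    card (interior_lattice_points (convex hull s)) * (((k + 1) choose 2) + (k choose 2))"
proof -
  let ?I = "interior_lattice_points (convex hull s)" and ?K = "convex hull s"
  note full = tight_imp_full[OF s]
  note fin = full_simplex_finite[OF full]
  have lat: "lattice_simplex s" using s by (simp add: tight_def)
  obtain q where q: "q \<in> interior ?K" "generic ?K q"
    using exists_generic[OF finite_imp_bounded_convex_hull[OF fin] interior_full_simplex_nonempty[OF full]] by blast
  have "?I \<inter> \<Union>{s} = {}" using vertex_notin_interior[OF full] by (auto simp: interior_lattice_points_def)
  then obtain T where T: "lattice_dissection T ?K" "card {s} + CARD('n) * card ?I \<le> card T"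
    using insert_interior_lattice_points[OF finite_interior_lattice_points[OF full]
        lattice_dissection_singleton[OF lat]] by blast
  note D = lattice_dissectionD[OF T(1)]
  have nv: "nvol ?K = real (CARD('n) * card ?I + 1)" using s by (simp add: tight_def)
  have "card T \<le> CARD('n) * card ?I + 1"
    using card_le_nvol(1)[OF T(1)] unfolding nv of_nat_le_iff .
  then have cT: "card T = CARD('n) * card ?I + 1" using T(2) by simp
  then have "real (card T) = nvol ?K" using nv by simp
  then have unimod: "nvol (convex hull t) = 1" if "t \<in> T" for t
    using card_le_nvol(2)[OF T(1)] that by blast
  have cardT: "card T = 2 * card ?I + 1" using cT n2 by simp
  have ft: "full_simplex t" "t \<subseteq> ?K" if "t \<in> T" for t
    using dissectionD(2)[OF D(1) that] dissectionD(5)[OF D(1) that] hull_subset[of t convex] by auto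
  have gen: "bary t q u \<noteq> 0" if "t \<in> T" "u \<in> t" for t u
    using genericD[OF q(2) D(2)[OF that(1)] ft(2)[OF that(1)] that(2)] .
  let ?r = "\<lambda>t. card (visible t q)"
  have r2: "?r t \<le> 2" if "t \<in> T" for t using card_visible_le[OF ft(1)[OF that], of q] n2 by simp
  have count: "dilate_count j ?K = card {t \<in> T. ?r t = 0} * ((j + 2) choose 2) +
      card {t \<in> T. ?r t = 1} * ((j + 1) choose 2) + card {t \<in> T. ?r t = 2} * (j choose 2)" if j: "0 < j" for j
  proof -
    have "dilate_count j ?K = dilate_count j (half_open q ?K)"
      by (simp add: half_open_interior_simplex[OF full q(1)])
    also have "\<dots> = (\<Sum>t\<in>T. dilate_count j (half_open q (convex hull t)))"
      by (rule dilate_count_dissection[OF D(1) gen j])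
    also have "\<dots> = (\<Sum>t\<in>T. (j + 2 - ?r t) choose 2)"
      by (rule sum.cong[OF refl]) (simp add: unimodular_half_open_count[OF D(2) unimod gen j] n2)
    also have "\<dots> = card {t \<in> T. ?r t = 0} * ((j + 2 - 0) choose 2) +
        card {t \<in> T. ?r t = 1} * ((j + 2 - 1) choose 2) + card {t \<in> T. ?r t = 2} * ((j + 2 - 2) choose 2)"
      by (rule sum_by_value_le_2[OF D(3) r2])
    finally show ?thesis by simp
  qed
  \<comment> \<open>The only triangle without visible edges is the one that contains \<open>q\<close>, so \<open>h\<^sub>0 = 1\<close>.\<close>
  have "\<exists>!t. t \<in> T \<and> ?r t = 0"
  proof -
    have r0: "?r t = 0 \<longleftrightarrow> q \<in> interior (convex hull t)" if "t \<in> T" for t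
    proof
      assume "?r t = 0"
      then have "visible t q = {}" using full_simplex_finite[OF ft(1)[OF that]] by (simp add: visible_def)
      then have "0 < bary t q u" if "u \<in> t" for u
        using that gen[OF \<open>t \<in> T\<close> that] by (force simp: visible_def)
      then show "q \<in> interior (convex hull t)" by (simp add: interior_convex_hull_bary[OF ft(1)[OF that]])
    qed (simp add: interior_visible[OF ft(1)[OF that]])
    have "q \<in> half_open q ?K"
      using half_open_interior_simplex[OF full q(1)] q(1) interior_subset by blast
    then obtain t where t: "t \<in> T" "q \<in> half_open q (convex hull t)"
      using half_open_dissection(1)[OF D(1)] gen by blast
    then have "q \<in> interior (convex hull t)"
      using mem_half_open_simplex[OF ft(1)[OF t(1)]] gen[OF t(1)]
      by (auto simp: interior_convex_hull_bary[OF ft(1)[OF t(1)]])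
    then show ?thesis using r0 t(1) dissectionD(4)[OF D(1)] by blast
  qed
  then have h0: "card {t \<in> T. ?r t = 0} = 1"
    by (auto simp: card_1_singleton_iff Ex1_def)
  have "{y \<in> integer_lattice. y /\<^sub>R real 1 \<in> ?K} = s \<union> ?I"
  proof (intro set_eqI iffI)
    fix y assume "y \<in> {y \<in> integer_lattice. y /\<^sub>R real 1 \<in> ?K}"
    then show "y \<in> s \<union> ?I" using tight_lattice_point[OF s] by auto
  next
    fix y assume "y \<in> s \<union> ?I"
    then show "y \<in> {y \<in> integer_lattice. y /\<^sub>R real 1 \<in> ?K}"
      using lat hull_inc[of y s convex] interior_subset[of ?K]
      by (auto simp: lattice_simplex_def interior_lattice_points_def)
  qed
  moreover have "s \<inter> ?I = {}" using vertex_notin_interior[OF full] by (auto simp: interior_lattice_points_def)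
  ultimately have "dilate_count 1 ?K = card s + card ?I"
    unfolding dilate_count_def
    using card_Un_disjoint[OF fin finite_interior_lattice_points[OF full]] by simp
  then have "dilate_count 1 ?K = 3 + card ?I" using full n2 by (simp add: full_simplex_def)
  then have h1: "card {t \<in> T. ?r t = 1} = card ?I"
    using count[of 1] h0 by (simp add: numeral_2_eq_2)
  have "card T = card {t \<in> T. ?r t = 0} + card {t \<in> T. ?r t = 1} + card {t \<in> T. ?r t = 2}"
    using sum_by_value_le_2[where T=T and g="\<lambda>_. 1" and r="?r"] D(3) r2 by simp
  then have h2: "card {t \<in> T. ?r t = 2} = card ?I" using h0 h1 cardT by simp
  show ?thesis using count[OF k] h0 h1 h2 by (simp add: algebra_simps)
qed

lemma tight_count:
  fixes s :: "(real^'n) set"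
  assumes s: "tight s" and k: "0 < k"
  shows "dilate_count k (convex hull s) = ((k + CARD('n)) choose CARD('n)) +
    card (interior_lattice_points (convex hull s)) * (\<Sum>i=1..CARD('n). (k + CARD('n) - i) choose CARD('n))"
proof (cases "CARD('n) = 2")
  case True
  have "(\<Sum>i=1..CARD('n). (k + CARD('n) - i) choose CARD('n)) = ((k + 1) choose 2) + (k choose 2)"
    using True by (simp add: numeral_2_eq_2)
  then show ?thesis using tight_triangle_count[OF s True k] True by simp
next
  case False
  note full = tight_imp_full[OF s]
  obtain q where q: "q \<in> interior (convex hull s)" "generic (convex hull s) q"
    using exists_generic[OF finite_imp_bounded_convex_hull[OF full_simplex_finite[OF full]]
        interior_full_simplex_nonempty[OF full]] by blast
  show ?thesis
    using tight_half_open_count[OF s False q(2) hull_subset convex_convex_hull k]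
    by (simp add: half_open_interior_simplex[OF full q(1)] interior_visible[OF full q(1)])
qed

text \<open>
  The equations for \<open>k = 0, \<dots>, n\<close> form a unitriangular system for the coefficients, as
  \<open>(k + n - i) choose n\<close> vanishes for \<open>i > k\<close> and is \<open>1\<close> for \<open>i = k\<close>.
\<close>

lemma ehrhart_coeff_eqI:
  fixes P :: "(real^'n) set"
  assumes a: "\<And>k::nat. real (lattice_count ((\<lambda>x. real k *\<^sub>R x) ` P)) =
        (\<Sum>i=0..CARD('n). a i * real ((k + CARD('n) - i) choose CARD('n)))"
    and zero: "\<And>i. CARD('n) < i \<Longrightarrow> a i = 0"
  shows "ehrhart_coeff P = a"
  unfolding ehrhart_coeff_def
proof (rule the_equality)
  fix b assume b: "(\<forall>k::nat. real (lattice_count ((\<lambda>x. real k *\<^sub>R x) ` P)) =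
        (\<Sum>i=0..CARD('n). b i * real ((k + CARD('n) - i) choose CARD('n)))) \<and> (\<forall>i>CARD('n). b i = 0)"
  have "b i = a i" for i
  proof (induction i rule: less_induct)
    case (less i)
    show ?case
    proof (cases "i \<le> CARD('n)")
      case True
      have "0 = (\<Sum>j=0..CARD('n). (b j - a j) * real ((i + CARD('n) - j) choose CARD('n)))"
        using a[of i] b by (simp add: left_diff_distrib sum_subtractf)
      also have "\<dots> = (\<Sum>j\<in>{i}. (b j - a j) * real ((i + CARD('n) - j) choose CARD('n)))"
      proof (rule sum.mono_neutral_right)
        show "\<forall>j\<in>{0..CARD('n)} - {i}. (b j - a j) * real ((i + CARD('n) - j) choose CARD('n)) = 0"
        proof
          fix j assume j: "j \<in> {0..CARD('n)} - {i}"
          show "(b j - a j) * real ((i + CARD('n) - j) choose CARD('n)) = 0"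
          proof (cases "j < i")
            case False
            then have "i + CARD('n) - j < CARD('n)" using j by auto
            then show ?thesis by (simp add: binomial_eq_0)
          qed (simp add: less)
        qed
      qed (use True in auto)
      finally show ?thesis by simp
    qed (use b zero in simp)
  qed
  then show "b = a" by blast
qed (use a zero in blast)

lemma ehrhart_coeff_tight:
  fixes s :: "(real^'n) set"
  assumes s: "tight s" and i: "i \<in> {1..CARD('n)}"
  shows "ehrhart_coeff (convex hull s) i = real (card (interior_lattice_points (convex hull s)))"
proof -
  let ?n = "CARD('n)" and ?K = "convex hull s"
  let ?l = "card (interior_lattice_points ?K)"
  let ?a = "\<lambda>i. if i = 0 then 1 else if i \<le> ?n then real ?l else 0"
  have "ehrhart_coeff ?K = ?a"
  proof (rule ehrhart_coeff_eqI)
    fix k :: nat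
    have split: "(\<Sum>i=0..?n. ?a i * real ((k + ?n - i) choose ?n)) =
        real ((k + ?n) choose ?n) + real ?l * (\<Sum>i=1..?n. real ((k + ?n - i) choose ?n))"
    proof -
      have "(\<Sum>i=0..?n. ?a i * real ((k + ?n - i) choose ?n)) =
          real ((k + ?n) choose ?n) + (\<Sum>i=1..?n. ?a i * real ((k + ?n - i) choose ?n))"
        by (subst sum.atLeast_Suc_atMost) simp_all
      also have "(\<Sum>i=1..?n. ?a i * real ((k + ?n - i) choose ?n)) =
          (\<Sum>i=1..?n. real ?l * real ((k + ?n - i) choose ?n))"
        by (rule sum.cong) auto
      finally show ?thesis by (simp add: sum_distrib_left)
    qed
    show "real (lattice_count ((\<lambda>x. real k *\<^sub>R x) ` ?K)) = (\<Sum>i=0..?n. ?a i * real ((k + ?n - i) choose ?n))"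
    proof (cases "k = 0")
      case True
      have "?K \<noteq> {}" using interior_full_simplex_nonempty[OF tight_imp_full[OF s]] interior_subset by blast
      then have "(\<lambda>x. real k *\<^sub>R x) ` ?K \<inter> integer_lattice = {0}"
        unfolding True by (auto simp: integer_lattice_def image_constant_conv simp del: convex_hull_eq_empty)
      then have "lattice_count ((\<lambda>x. real k *\<^sub>R x) ` ?K) = 1" by (simp add: lattice_count_def)
      moreover have "(\<Sum>i=1..?n. real ((k + ?n - i) choose ?n)) = 0"
        using True by (intro sum.neutral) (auto simp: binomial_eq_0)
      ultimately show ?thesis unfolding split using True by simp
    next
      case False
      then show ?thesis
        unfolding split using lattice_count_dilate[of k ?K] tight_count[OF s, of k] by simp
    qed
  qed auto
  then show ?thesis using i by simp
qed

section \<open>The reference simplex and the theorem\<close>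

definition reference_vertices :: "nat \<Rightarrow> (real^'n) set" where
  "reference_vertices l = insert (- (real l *\<^sub>R 1)) (range (\<lambda>i. axis i 1))"

lemma S_simplex_eq: "S_simplex l = convex hull (reference_vertices l :: (real^'n) set)"
proof -
  have "(\<Sum>i\<in>UNIV. axis i 1 :: real^'n) = 1"
    by (simp add: vec_eq_iff axis_def)
  then show ?thesis by (simp add: S_simplex_def reference_vertices_def)
qed

lemma axis_ne_apex: "axis i 1 \<noteq> - (real l *\<^sub>R (1 :: real^'n))"
proof
  assume "axis i 1 = - (real l *\<^sub>R (1 :: real^'n))"
  then have "axis i 1 $ i = (- (real l *\<^sub>R (1 :: real^'n))) $ i" by (rule arg_cong)
  then show False by simp
qed

lemma apex_notin_range_axis: "- (real l *\<^sub>R 1) \<notin> range (\<lambda>i::'n::finite. axis i (1::real))"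
  using axis_ne_apex by (metis imageE)

lemma inj_axis: "inj (\<lambda>i::'n::finite. axis i (1::real))"
  by (rule injI) (simp add: axis_eq_axis)

text \<open>
  The barycentric coordinate at the vertex \<open>- l (1, \<dots>, 1)\<close>.
\<close>

definition reference_coord :: "nat \<Rightarrow> real^'n \<Rightarrow> real" where
  "reference_coord l x = (1 - (\<Sum>i\<in>UNIV. x $ i)) / (real CARD('n) * real l + 1)"

lemma
  fixes x :: "real^'n"
  shows full_reference: "full_simplex (reference_vertices l :: (real^'n) set)"
    and bary_reference_apex: "bary (reference_vertices l) x (- (real l *\<^sub>R 1)) = reference_coord l x"
    and bary_reference_axis: "bary (reference_vertices l) x (axis i 1) = x $ i + real l * reference_coord l x"
proof -
  let ?z = "- (real l *\<^sub>R 1) :: real^'n" and ?s = "reference_vertices l :: (real^'n) set"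
  let ?N = "real CARD('n) * real l + 1"
  define u where "u = (\<lambda>x v. if v = ?z then reference_coord l x else x \<bullet> v + real l * reference_coord l x)"
  have "0 < ?N" by (simp add: add_nonneg_pos)
  then have N: "?N * reference_coord l y = 1 - (\<Sum>i\<in>UNIV. y $ i)" for y :: "real^'n"
    by (simp add: reference_coord_def)
  have fin: "finite ?s" by (simp add: reference_vertices_def)
  have u_axis: "u y (axis i 1) = y $ i + real l * reference_coord l y" for y i
    using axis_ne_apex[of i l] by (simp add: u_def inner_axis)
  have sum_s: "(\<Sum>v\<in>?s. f v) = f ?z + (\<Sum>i\<in>UNIV. f (axis i 1))" for f :: "_ \<Rightarrow> 'b::comm_monoid_add"
    unfolding reference_vertices_def using apex_notin_range_axis[of l]
    by (subst sum.insert) (auto simp: sum.reindex[OF inj_axis])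
  have sum1: "sum (u y) ?s = 1" for y
  proof -
    have "sum (u y) ?s = reference_coord l y + (\<Sum>i\<in>UNIV. y $ i + real l * reference_coord l y)"
      unfolding sum_s u_axis by (simp add: u_def)
    also have "\<dots> = ?N * reference_coord l y + (\<Sum>i\<in>UNIV. y $ i)"
      by (simp add: sum.distrib algebra_simps)
    finally show ?thesis using N by simp
  qed
  have axis_sum: "(\<Sum>i\<in>UNIV. f i *\<^sub>R (axis i 1 :: real^'n)) $ j = f j" for f j
  proof -
    have "(\<Sum>i\<in>UNIV. f i *\<^sub>R (axis i 1 :: real^'n)) $ j = (\<Sum>i\<in>UNIV. if i = j then f i else 0)"
      unfolding sum_component by (rule sum.cong) (auto simp: axis_def)
    then show ?thesis by simp
  qed
  have comb: "(\<Sum>v\<in>?s. u y v *\<^sub>R v) = y" for y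
  proof -
    have "(\<Sum>v\<in>?s. u y v *\<^sub>R v) $ j = y $ j" for j
    proof -
      have "(\<Sum>v\<in>?s. u y v *\<^sub>R v) = reference_coord l y *\<^sub>R ?z +
          (\<Sum>i\<in>UNIV. (y $ i + real l * reference_coord l y) *\<^sub>R axis i 1)"
        unfolding sum_s u_axis by (simp add: u_def)
      then show ?thesis by (simp only: vector_add_component axis_sum) simp
    qed
    then show ?thesis by (simp add: vec_eq_iff)
  qed
  have "y \<in> affine hull ?s" for y
    unfolding affine_hull_finite[OF fin] using sum1[of y] comb[of y] by blast
  moreover have "card ?s = Suc CARD('n)"
    unfolding reference_vertices_def using apex_notin_range_axis[of l, where 'n='n] card_image[OF inj_axis] by simp
  ultimately show full: "full_simplex ?s" by (auto simp: full_simplex_def)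
  show "bary ?s x ?z = reference_coord l x"
    using bary_unique[OF full sum1 comb, of ?z x] by (simp add: u_def reference_vertices_def)
  show "bary ?s x (axis i 1) = x $ i + real l * reference_coord l x"
    using bary_unique[OF full sum1 comb, of "axis i 1" x] by (simp add: u_axis reference_vertices_def)
qed

text \<open>
  The coordinates of \<open>y\<close> at the unit vectors are positive, smaller than \<open>1\<close> and differ from each
  other by integers, so they are equal. Hence \<open>y\<close> is a multiple of \<open>(1, \<dots>, 1)\<close>, and the signs of the
  coordinates bound the factor.
\<close>

lemma interior_lattice_points_reference:
  "interior_lattice_points (convex hull (reference_vertices l :: (real^'n) set)) = (\<lambda>j. - (real j *\<^sub>R 1)) ` {..<l}"
proof -
  let ?s = "reference_vertices l :: (real^'n) set" and ?c = "reference_coord l :: real^'n \<Rightarrow> real"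
  let ?N = "real CARD('n) * real l + 1"
  have N: "0 < ?N" by (simp add: add_nonneg_pos)
  have interior: "y \<in> interior (convex hull ?s) \<longleftrightarrow> 0 < ?c y \<and> (\<forall>i. 0 < y $ i + real l * ?c y)" for y
  proof -
    have "y \<in> interior (convex hull ?s) \<longleftrightarrow> (\<forall>v\<in>?s. 0 < bary ?s y v)"
      unfolding interior_convex_hull_bary[OF full_reference] by simp
    also have "\<dots> \<longleftrightarrow> 0 < bary ?s y (- (real l *\<^sub>R 1)) \<and> (\<forall>i. 0 < bary ?s y (axis i 1))"
      by (auto simp: reference_vertices_def)
    finally show ?thesis unfolding bary_reference_apex bary_reference_axis .
  qed
  have c: "?c (- (real j *\<^sub>R 1)) = (1 + real CARD('n) * real j) / ?N" for j
    by (simp add: reference_coord_def sum_negf)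
  show ?thesis
  proof
    show "(\<lambda>j. - (real j *\<^sub>R 1)) ` {..<l} \<subseteq> interior_lattice_points (convex hull ?s)"
    proof (rule image_subsetI)
      fix j assume j: "j \<in> {..<l}"
      have "0 < ?c (- (real j *\<^sub>R 1))" unfolding c using N by (simp add: add_pos_nonneg)
      moreover have "- real j + real l * ?c (- (real j *\<^sub>R 1)) = (real l - real j) / ?N"
        unfolding c using N by (simp add: field_simps)
      then have "0 < - real j + real l * ?c (- (real j *\<^sub>R 1))" using j N by simp
      ultimately have "- (real j *\<^sub>R 1) \<in> interior (convex hull ?s)" unfolding interior by simp
      then show "- (real j *\<^sub>R 1) \<in> interior_lattice_points (convex hull ?s)"
        by (simp add: interior_lattice_points_def integer_lattice_def)
    qed
    show "interior_lattice_points (convex hull ?s) \<subseteq> (\<lambda>j. - (real j *\<^sub>R 1)) ` {..<l}"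
    proof
      fix y :: "real^'n" assume "y \<in> interior_lattice_points (convex hull ?s)"
      then have int: "\<And>i. y $ i \<in> \<int>" and c0: "0 < ?c y" and pos: "\<And>i. 0 < y $ i + real l * ?c y"
        using interior by (auto simp: interior_lattice_points_def integer_lattice_def)
      have Nc: "?N * ?c y = 1 - (\<Sum>i\<in>UNIV. y $ i)" using N by (simp add: reference_coord_def)
      have total: "(\<Sum>i\<in>UNIV. y $ i + real l * ?c y) = 1 - ?c y"
        using Nc by (simp add: sum.distrib algebra_simps)
      have less1: "y $ i + real l * ?c y < 1" for i
      proof -
        have "y $ i + real l * ?c y \<le> (\<Sum>i\<in>UNIV. y $ i + real l * ?c y)"
          using pos by (intro member_le_sum) (auto intro: less_imp_le)
        then show ?thesis using total c0 by simp
      qed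
      have const: "y $ i = y $ j" for i j
      proof -
        have "\<bar>y $ i - y $ j\<bar> < 1" using less1[of i] less1[of j] pos[of i] pos[of j] by linarith
        moreover have "y $ i - y $ j \<in> \<int>" using int by simp
        ultimately show ?thesis by (metis Ints_nonzero_abs_less1 eq_iff_diff_eq_0)
      qed
      define i0 :: 'n where "i0 = undefined"
      obtain z :: int where z: "y $ i0 = of_int z" using int[of i0] by (auto elim: Ints_cases)
      have yz: "y $ i = of_int z" for i using const[of i i0] z by simp
      have Nz: "?N * ?c y = 1 - real CARD('n) * of_int z" using Nc yz by simp
      have "0 < ?N * ?c y" using N c0 by simp
      then have nz: "real CARD('n) * of_int z < 1" using Nz by simp
      have "z \<le> 0"
      proof (rule ccontr)
        assume "\<not> z \<le> 0"
        then have "1 \<le> real_of_int z" by simp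
        moreover have "1 \<le> real CARD('n)" by (simp add: Suc_leI)
        ultimately have "1 * 1 \<le> real CARD('n) * of_int z" by (intro mult_mono) auto
        then show False using nz by simp
      qed
      moreover have "- int l < z"
      proof -
        have "0 < ?N * (of_int z + real l * ?c y)" using N pos[of i0] yz by simp
        also have "?N * (of_int z + real l * ?c y) = ?N * of_int z + real l * (?N * ?c y)"
          by (simp add: algebra_simps)
        also have "\<dots> = of_int z + real l" unfolding Nz by (simp add: algebra_simps)
        finally show ?thesis by linarith
      qed
      ultimately have "nat (- z) \<in> {..<l}" "y = - (real (nat (- z)) *\<^sub>R 1)"
        using yz by (auto simp: vec_eq_iff)
      then show "y \<in> (\<lambda>j. - (real j *\<^sub>R 1)) ` {..<l}" by blast
    qed
  qed
qed

lemma card_interior_lattice_points_reference: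
  "card (interior_lattice_points (convex hull (reference_vertices l :: (real^'n) set))) = l"
proof -
  have "inj_on (\<lambda>j. - (real j *\<^sub>R 1) :: real^'n) {..<l}"
    by (auto simp: inj_on_def vec_eq_iff)
  then show ?thesis unfolding interior_lattice_points_reference by (simp add: card_image)
qed

text \<open>
  The matrix is \<open>I + l J\<close> with \<open>J\<close> the all-ones matrix. It maps \<open>(1, \<dots>, 1)\<close> to \<open>(n l + 1)\<close> times
  itself, so its \<open>k\<close>-th column may be replaced by the constant \<open>n l + 1\<close> (Cramer's rule). What
  results is a product of two matrices that differ from the identity only in the \<open>k\<close>-th column and
  only in the \<open>k\<close>-th row.
\<close>

lemma det_edge_matrix_reference:
  "det (edge_matrix (\<lambda>i::'n::finite. axis i 1) (- (real l *\<^sub>R 1))) = real CARD('n) * real l + 1"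
proof -
  define k :: 'n where "k = undefined"
  let ?M = "edge_matrix (\<lambda>i::'n::finite. axis i 1) (- (real l *\<^sub>R 1))" and ?N = "real CARD('n) * real l + 1"
  \<comment> \<open>\<open>?B\<close> is the identity with its \<open>k\<close>-th column replaced, \<open>?C\<close> the identity with its \<open>k\<close>-th row replaced, both in the form that Cramer's rule evaluates.\<close>
  let ?B = "\<chi> i j. if j = k then (mat 1 *v (1::real^'n)) $ i else (mat 1 :: real^'n^'n) $ i $ j"
  let ?x = "\<chi> j. if j = k then ?N else real l"
  let ?C = "(\<chi> i. if i = k then (\<Sum>i\<in>UNIV. ?x $ i *s row i (mat 1)) else row i (mat 1)) :: real^'n^'n"
  have M: "?M $ i $ j = (if i = j then 1 else 0) + real l" for i j
    by (simp add: edge_matrix_def axis_def)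
  have row: "row i (mat 1) $ j = (if i = j then 1 else 0 :: real)" for i j :: 'n
    by (simp add: row_def mat_def)
  have Mv: "?M *v 1 = ?N *\<^sub>R 1"
    by (simp add: vec_eq_iff matrix_vector_mult_def M sum.distrib)
  have "det ?M = det (\<chi> i j. if j = k then ?N else ?M $ i $ j)"
    using cramer_lemma[of k ?M 1,
        unfolded Mv vector_scaleR_component one_index real_scaleR_def mult_1_right mult_1_left] by (rule sym)
  also have "(\<chi> i j. if j = k then ?N else ?M $ i $ j) = ?B ** ?C"
  proof -
    have rows: "(\<Sum>i\<in>UNIV. ?x $ i *s row i (mat 1)) $ j = ?x $ j" for j
    proof -
      have "(\<Sum>i\<in>UNIV. ?x $ i *s row i (mat 1)) $ j = (\<Sum>i\<in>UNIV. if i = j then ?x $ i else 0)"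
        unfolding sum_component by (rule sum.cong) (simp_all add: row)
      then show ?thesis by (simp only: sum.delta finite UNIV_I if_True)
    qed
    have C: "?C $ m $ j = (if m = k then ?x $ j else if m = j then 1 else 0)" for m j
      by (simp only: vec_lambda_beta[where 'a="real^'n"] if_distrib[of "\<lambda>v. v $ j"] rows row)
    have B: "?B $ i $ m = (if m = k then 1 else if i = m then 1 else 0)" for i m
      unfolding matrix_vector_mul_lid by (simp add: mat_def)
    have "(?B ** ?C) $ i $ j = (if j = k then ?N else ?M $ i $ j)" for i j
    proof -
      have "(?B ** ?C) $ i $ j = (\<Sum>m\<in>UNIV. ?B $ i $ m * ?C $ m $ j)"
        by (simp add: matrix_matrix_mult_def)
      also have "\<dots> = (\<Sum>m\<in>UNIV. (if m = k then ?x $ j else 0) + (if m = j then (if m \<noteq> k \<and> i = m then 1 else 0) else 0))"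
        unfolding B C by (rule sum.cong) auto
      also have "\<dots> = ?x $ j + (if j \<noteq> k \<and> i = j then 1 else 0)"
        by (simp add: sum.distrib)
      finally show ?thesis by (auto simp: M)
    qed
    then show ?thesis by (simp add: vec_eq_iff)
  qed
  also have "det \<dots> = det ?B * det ?C" by (rule det_mul)
  also have "det ?B = 1" unfolding cramer_lemma by simp
  also have "det ?C = ?N" unfolding cramer_lemma_transpose by simp
  finally show ?thesis by simp
qed

lemma tight_reference: "tight (reference_vertices l :: (real^'n) set)"
proof -
  let ?s = "reference_vertices l :: (real^'n) set" and ?z = "- (real l *\<^sub>R 1) :: real^'n"
  have z: "?z \<in> ?s" by (simp add: reference_vertices_def)
  have "?s - {?z} = range (\<lambda>i. axis i 1)"
    unfolding reference_vertices_def by (rule Diff_insert_absorb[OF apex_notin_range_axis])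
  then have f: "bij_betw (\<lambda>i. axis i 1) UNIV (?s - {?z})"
    using inj_axis by (simp add: bij_betw_def)
  have "nvol (convex hull ?s) = real CARD('n) * real l + 1"
    unfolding nvol_def measure_simplex[OF full_reference z f] det_edge_matrix_reference by simp
  moreover have "?s \<subseteq> integer_lattice"
    by (auto simp: reference_vertices_def integer_lattice_def axis_def)
  ultimately show ?thesis
    by (simp add: tight_def lattice_simplex_def full_reference card_interior_lattice_points_reference)
qed

text \<open>
  A triangulation \<open>T\<close> of \<open>P\<close> on the vertices satisfies \<open>|T| + n l \<le> nvol P = n l + 1\<close>, so it
  consists of one simplex.
\<close>

lemma minimal_volume_imp_tight_simplex:
  fixes P :: "(real^'n) set"
  assumes P: "P \<in> lattice_polytopes_interior l" and vol: "nvol P = real CARD('n) * real l + 1"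
  shows "\<exists>s. tight s \<and> P = convex hull s \<and> card (interior_lattice_points P) = l"
proof -
  have poly: "polytope P" and dim: "aff_dim P = int CARD('n)"
    and vert: "\<And>v. v extreme_point_of P \<Longrightarrow> v \<in> integer_lattice"
    and l: "card (interior_lattice_points P) = l"
    using P by (auto simp: lattice_polytopes_interior_def lattice_polytopes_def lattice_count_def interior_lattice_points_def)
  let ?V = "{v. v extreme_point_of P}"
  have finV: "finite ?V" using poly finite_polyhedron_extreme_points polytope_imp_polyhedron by blast
  have hull: "convex hull ?V = P"
    using Krein_Milman_Minkowski[of P] poly polytope_imp_compact polytope_imp_convex by blast
  have "affine hull ?V = UNIV"
    using dim aff_dim_eq_full[of ?V] aff_dim_convex_hull[of ?V] by (simp add: hull)
  then obtain T where T: "dissection T P" "\<Union>T \<subseteq> ?V"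
    using regular_triangulation[OF finV] hull by auto
  have L: "lattice_dissection T P"
    using T vert by (auto simp: lattice_dissection_def)
  have "finite (interior_lattice_points P)"
    unfolding interior_lattice_points_def using poly polytope_imp_bounded
    by (intro finite_lattice_points bounded_subset[OF _ interior_subset]) blast
  moreover have "interior_lattice_points P \<inter> \<Union>T = {}"
    using T(2) extreme_point_not_in_interior unfolding interior_lattice_points_def by blast
  ultimately have "real (card T + CARD('n) * l) \<le> real (CARD('n) * l + 1)"
    using nvol_lower_bound[OF _ L subset_refl] vol l by simp
  then have "card T \<le> 1" unfolding of_nat_le_iff by simp
  moreover have "T \<noteq> {}"
  proof
    assume "T = {}"
    then have "P = {}" using dissectionD(3)[OF T(1)] by simp
    then show False using dim by simp
  qed
  ultimately have "card T = 1" using dissectionD(1)[OF T(1)] by (metis card_0_eq less_one nat_less_le)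
  then obtain s where s: "T = {s}" using card_1_singletonE by blast
  then have "P = convex hull s" using dissectionD(3)[OF T(1)] by simp
  moreover have "lattice_simplex s" using lattice_dissectionD(2)[OF L] s by simp
  ultimately show ?thesis using vol l by (auto simp: tight_def)
qed

theorem proposition1p3:
  fixes P :: "(real ^ 'n) set" and l :: nat
  assumes "l \<ge> 1"
    and "P \<in> lattice_polytopes_interior l"
    and "measure lebesgue P = (real CARD('n) * real l + 1) / fact CARD('n)"
  shows "\<forall>i\<in>{1..CARD('n)}.
    ehrhart_coeff P i = ehrhart_coeff (S_simplex l :: (real ^ 'n) set) i \<and>
    ehrhart_coeff (S_simplex l :: (real ^ 'n) set) i = real l"
proof -
  have "nvol P = real CARD('n) * real l + 1" using assms(3) by (simp add: nvol_def)
  then obtain s where "tight s" "P = convex hull s" "card (interior_lattice_points P) = l"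
    using minimal_volume_imp_tight_simplex[OF assms(2)] by blast
  then have "ehrhart_coeff P i = real l" if "i \<in> {1..CARD('n)}" for i
    using ehrhart_coeff_tight[OF _ that] by blast
  moreover have "ehrhart_coeff (S_simplex l :: (real ^ 'n) set) i = real l" if "i \<in> {1..CARD('n)}" for i
    using ehrhart_coeff_tight[OF tight_reference that, of l]
    by (simp add: S_simplex_eq card_interior_lattice_points_reference)
  ultimately show ?thesis by simp
qed

end
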